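(* Let $S$ be a dense subsemigroup of $((0,\infty),+)$ such that $cS$ is central$^{*}$ near zero for every $c\in\mathbb{N}$, and let $M$ be an $\omega\times\omega$ segmented image partition regular matrix with entries from $\mathbb{Q}$. Then $M$ is centrally image partition regular near zero over $S$.
   Context: $\omega=\{0,1,2,\ldots\}$, $\mathbb{N}=\{1,2,3,\ldots\}$. "Dense" means dense in $(0,\infty)$ with the usual topology. A $u\times v$ matrix $A$ ($u,v\in\mathbb{N}$) with rational entries is image partition regular (over $\mathbb{N}$) if for every finite coloring of $\mathbb{N}$ there is $\vec x\in\mathbb{N}^{v}$ such that all entries of $A\vec x$ lie in $\mathbb{N}$ and have the same color. An $\omega\times\omega$ matrix $M=(a_{i,j})$ with entries from $\mathbb{Q}$ is a segmented image partition regular matrix if: (1) no row of $M$ is $\vec 0$; (2) for each $i\in\omega$, $\{j\in\omega: a_{i,j}\neq 0\}$ is finite; and (3) there is a (strictly) increasing sequence $\langle\alpha_{n}\rangle_{n=0}^{\infty}$ in $\omega$ with $\alpha_{0}=0$ such that for each $n\in\omega$ the set $\{\langle a_{i,\alpha_{n}},a_{i,\alpha_{n}+1},\ldots,a_{i,\alpha_{n+1}-1}\rangle: i\in\omega\}\setminus\{\vec 0\}$ is empty or is the set of rows of a finite image partition regular matrix. Let $\beta S_d$ be the Stone-Čech compactification of $S$ with the discrete topology, viewed as the set of ultrafilters on $S$, with the operation given by $B\in p+q$ iff $\{x\in S: -x+B\in q\}\in p$, where $-x+B=\{y\in S: x+y\in B\}$. Let $0^{+}(S)=\{p\in\beta S_d: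 (0,\epsilon)\cap S\in p \text{ for all } \epsilon>0\}$, a compact right topological subsemigroup of $\beta S_d$. A minimal idempotent of $0^{+}(S)$ is an idempotent in the smallest two-sided ideal of $0^{+}(S)$. A set $C\subseteq S$ is central near zero if $C\in p$ for some minimal idempotent $p$ of $0^{+}(S)$, and is central$^{*}$ near zero if $C\in p$ for every minimal idempotent $p$ of $0^{+}(S)$. An $\omega\times\omega$ matrix $M$ with rational entries is centrally image partition regular near zero over $S$ if for every $C\subseteq S$ that is central near zero there is $\vec x\in S^{\omega}$ with $M\vec x\in C^{\omega}$. *)

theory Defs
  imports
    "HOL-Analysis.Elementary_Topology"
    "Jordan_Normal_Form.Matrix"
begin

text \<open>The positive integers are the \<open>n :: nat\<close> with \<open>0 < n\<close>; the value of a coloring at \<open>0\<close> is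
  never used.\<close>

definition image_partition_regular :: "rat mat \<Rightarrow> bool" where
  "image_partition_regular A \<longleftrightarrow>
     0 < dim_row A \<and> 0 < dim_col A \<and>
     (\<forall>\<chi> :: nat \<Rightarrow> nat. finite (\<chi> ` {0<..}) \<longrightarrow>
        (\<exists>x c. dim_vec x = dim_col A \<and> (\<forall>j < dim_col A. 0 < x $ j) \<and>
           (\<forall>i < dim_row A. \<exists>m :: nat. 0 < m \<and> \<chi> m = c \<and>
              (A *\<^sub>v map_vec of_nat x) $ i = of_nat m)))"

text \<open>The nonzero rows of the block of columns \<open>k, \<dots>, l - 1\<close> of \<open>M\<close>.\<close>

definition block_rows :: "(nat \<Rightarrow> nat \<Rightarrow> rat) \<Rightarrow> nat \<Rightarrow> nat \<Rightarrow> rat vec set" where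
  "block_rows M k l = range (\<lambda>i. vec (l - k) (\<lambda>j. M i (k + j))) - {0\<^sub>v (l - k)}"

definition segmented_image_partition_regular :: "(nat \<Rightarrow> nat \<Rightarrow> rat) \<Rightarrow> bool" where
  "segmented_image_partition_regular M \<longleftrightarrow>
     (\<forall>i. \<exists>j. M i j \<noteq> 0) \<and>
     (\<forall>i. finite {j. M i j \<noteq> 0}) \<and>
     (\<exists>\<alpha> :: nat \<Rightarrow> nat. strict_mono \<alpha> \<and> \<alpha> 0 = 0 \<and>
        (\<forall>n. block_rows M (\<alpha> n) (\<alpha> (Suc n)) = {} \<or>
             (\<exists>A. image_partition_regular A \<and>
                  block_rows M (\<alpha> n) (\<alpha> (Suc n)) = set (rows A))))"

text \<open>A point of the Stone-Cech compactification of the discrete space \<open>S\<close> is an ultrafilter,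
  given as a family of subsets of \<open>S\<close>.\<close>

definition stone_cech :: "'a set \<Rightarrow> 'a set set set" where
  "stone_cech S = {p. p \<subseteq> Pow S \<and> S \<in> p \<and> {} \<notin> p \<and>
     (\<forall>A\<in>p. \<forall>B\<in>p. A \<inter> B \<in> p) \<and>
     (\<forall>A\<in>p. \<forall>B. A \<subseteq> B \<and> B \<subseteq> S \<longrightarrow> B \<in> p) \<and>
     (\<forall>A. A \<subseteq> S \<longrightarrow> A \<in> p \<or> S - A \<in> p)}"

definition ultra_add :: "'a::plus set \<Rightarrow> 'a set set \<Rightarrow> 'a set set \<Rightarrow> 'a set set" where
  "ultra_add S p q = {B. B \<subseteq> S \<and> {x\<in>S. {y\<in>S. x + y \<in> B} \<in> q} \<in> p}"

definition zero_plus :: "real set \<Rightarrow> real set set set" where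
  "zero_plus S = {p \<in> stone_cech S. \<forall>\<epsilon>>0. {0<..<\<epsilon>} \<inter> S \<in> p}"

definition two_sided_ideal :: "('a \<Rightarrow> 'a \<Rightarrow> 'a) \<Rightarrow> 'a set \<Rightarrow> 'a set \<Rightarrow> bool" where
  "two_sided_ideal f T I \<longleftrightarrow>
     I \<noteq> {} \<and> I \<subseteq> T \<and> (\<forall>t\<in>T. \<forall>x\<in>I. f t x \<in> I \<and> f x t \<in> I)"

text \<open>The smallest two-sided ideal, when there is one (as in every compact right topological
  semigroup), is the intersection of all two-sided ideals.\<close>

definition smallest_ideal :: "('a \<Rightarrow> 'a \<Rightarrow> 'a) \<Rightarrow> 'a set \<Rightarrow> 'a set" where
  "smallest_ideal f T = \<Inter> {I. two_sided_ideal f T I}"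

lemma smallest_ideal_eqI:
  assumes "two_sided_ideal f T K" and "\<And>I. two_sided_ideal f T I \<Longrightarrow> K \<subseteq> I"
  shows "smallest_ideal f T = K"
  unfolding smallest_ideal_def using assms by blast

definition minimal_idempotent_near_zero :: "real set \<Rightarrow> real set set \<Rightarrow> bool" where
  "minimal_idempotent_near_zero S p \<longleftrightarrow>
     p \<in> smallest_ideal (ultra_add S) (zero_plus S) \<and> ultra_add S p p = p"

definition central_near_zero :: "real set \<Rightarrow> real set \<Rightarrow> bool" where
  "central_near_zero S C \<longleftrightarrow>
     C \<subseteq> S \<and> (\<exists>p. minimal_idempotent_near_zero S p \<and> C \<in> p)"

definition central_star_near_zero :: "real set \<Rightarrow> real set \<Rightarrow> bool" where
  "central_star_near_zero S C \<longleftrightarrow>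
     C \<subseteq> S \<and> (\<forall>p. minimal_idempotent_near_zero S p \<longrightarrow> C \<in> p)"

definition dense_subsemigroup :: "real set \<Rightarrow> bool" where
  "dense_subsemigroup S \<longleftrightarrow>
     S \<subseteq> {0<..} \<and> (\<forall>x\<in>S. \<forall>y\<in>S. x + y \<in> S) \<and> {0<..} \<subseteq> closure S"

text \<open>Meant for row-finite matrices; a row of infinite support yields the junk value \<open>0\<close>, which is
  not a positive real.\<close>

definition mat_image :: "(nat \<Rightarrow> nat \<Rightarrow> rat) \<Rightarrow> (nat \<Rightarrow> real) \<Rightarrow> nat \<Rightarrow> real" where
  "mat_image M x i = (\<Sum>j | M i j \<noteq> 0. of_rat (M i j) * x j)"

definition centrally_image_partition_regular_near_zero ::
    "real set \<Rightarrow> (nat \<Rightarrow> nat \<Rightarrow> rat) \<Rightarrow> bool" where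
  "centrally_image_partition_regular_near_zero S M \<longleftrightarrow>
     (\<forall>C. central_near_zero S C \<longrightarrow>
        (\<exists>x. (\<forall>j. x j \<in> S) \<and> (\<forall>i. mat_image M x i \<in> C)))"

end

theory Submission
  imports Defs "HOL-Analysis.Elementary_Metric_Spaces" "HOL-Library.Function_Algebras"
begin

text \<open>Let \<open>P\<close> be a minimal idempotent near zero and \<open>C \<in> P\<close>. The infinite system is solved one block
  of columns at a time. Inside \<open>C\<close> the set of the \<open>x\<close> with \<open>-x + C \<in> P\<close> is again in \<open>P\<close>
  (\<open>idempotent_star\<close>), and if the partial row sums obtained so far lie in this set, then the values of
  the next block only have to be chosen in a certain member of \<open>P\<close>. There are finitely many distinct
  partial row sums, because a block has finitely many distinct rows. Hence it suffices to show that
  every member of \<open>P\<close> contains the entries of \<open>A x\<close> for a vector \<open>x\<close> over \<open>S\<close>, for each finite image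
  partition regular matrix \<open>A\<close> (\<open>image_partition_regular_in_minimal_idempotent\<close>).

  For this, \<open>A\<close> is reduced to a first entries matrix: there is a matrix \<open>G\<close> over the natural numbers
  without zero rows such that \<open>B = A G\<close> has natural entries and the first nonzero entry of a row of
  \<open>B\<close> is determined by its column (\<open>image_partition_regular_first_entries\<close>). The matrix \<open>G\<close> comes
  from colorings that see the logarithm of a number. Among numbers of the same color, any two are
  nearly equal or of very different size. So in a limit of monochromatic images \<open>A x\<close>, entries of \<open>A x\<close>
  of the same order of magnitude have the same leading term. Each order of magnitude, among the
  entries of \<open>x\<close> and \<open>A x\<close> together, gives one column of \<open>G\<close>: a vector that \<open>A\<close> maps to leading terms
  (\<open>leading_terms\<close>). The limits are real, and they are replaced by rational vectors with the same
  rational linear relations (\<open>rational_approximation\<close>); vanishing and equality of entries are such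
  relations, and positivity survives a small perturbation. The rational vectors
  are again values of the linear map in question, because its image is cut out by rational
  functionals (\<open>span_or_separated\<close>), which vanish on the limits by continuity.

  A first entries matrix \<open>B\<close> has images in every member of \<open>P\<close> (\<open>first_entries_ultrafilter\<close>): by
  induction on the columns there is an idempotent ultrafilter of vectors that every row of \<open>B\<close> maps
  to \<open>P\<close>. Here a first entry \<open>c\<close> requires \<open>c S \<in> P\<close>, which is the hypothesis on \<open>S\<close>, and minimality
  enters through the identity \<open>P + f = P\<close> for idempotents \<open>f\<close> in the left ideal of \<open>P\<close>
  (\<open>left_minimal_absorbs\<close>).\<close>

section \<open>Ultrafilters and their closed sets\<close>

abbreviation ultras :: "'a set set set" where
  "ultras \<equiv> stone_cech UNIV"

abbreviation ultra_plus :: "'a::plus set set \<Rightarrow> 'a set set \<Rightarrow> 'a set set" (infixl "\<boxplus>" 65) where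
  "p \<boxplus> q \<equiv> ultra_add UNIV p q"

lemma ultras_iff:
  "p \<in> ultras \<longleftrightarrow> UNIV \<in> p \<and> {} \<notin> p \<and> (\<forall>A\<in>p. \<forall>B\<in>p. A \<inter> B \<in> p) \<and>
     (\<forall>A\<in>p. \<forall>B. A \<subseteq> B \<longrightarrow> B \<in> p) \<and> (\<forall>A. A \<in> p \<or> - A \<in> p)"
  by (simp add: stone_cech_def Compl_eq_Diff_UNIV)

lemma ultra_mono: "p \<in> ultras \<Longrightarrow> A \<in> p \<Longrightarrow> A \<subseteq> B \<Longrightarrow> B \<in> p"
  by (simp add: ultras_iff)

lemma ultra_Int: "p \<in> ultras \<Longrightarrow> A \<inter> B \<in> p \<longleftrightarrow> A \<in> p \<and> B \<in> p"
  unfolding ultras_iff by blast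

lemma ultra_Compl: "p \<in> ultras \<Longrightarrow> - A \<in> p \<longleftrightarrow> A \<notin> p"
  unfolding ultras_iff using Compl_disjoint by metis

lemma ultra_UNIV: "p \<in> ultras \<Longrightarrow> UNIV \<in> p"
  by (simp add: ultras_iff)

lemma ultra_nonempty: "p \<in> ultras \<Longrightarrow> A \<in> p \<Longrightarrow> \<exists>x. x \<in> A"
  unfolding ultras_iff by blast

lemma ultra_eqI: "p \<in> ultras \<Longrightarrow> q \<in> ultras \<Longrightarrow> p \<subseteq> q \<Longrightarrow> p = q"
  using ultra_Compl by blast

lemma ultra_UnI: "p \<in> ultras \<Longrightarrow> A \<in> p \<or> B \<in> p \<Longrightarrow> A \<union> B \<in> p"
  using ultra_mono[of p A "A \<union> B"] ultra_mono[of p B "A \<union> B"] by blast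

lemma ultra_INT:
  assumes "p \<in> ultras" "finite F" "\<And>i. i \<in> F \<Longrightarrow> A i \<in> p"
  shows "(\<Inter>i\<in>F. A i) \<in> p"
  using assms(2,3)
  by (induction F rule: finite_induct) (simp_all add: ultra_UNIV[OF assms(1)] ultra_Int[OF assms(1)])

lemma mem_ultra_plus: "B \<in> p \<boxplus> q \<longleftrightarrow> {x. {y. x + y \<in> B} \<in> q} \<in> p"
  by (simp add: ultra_add_def)

lemma ultra_plus_closed:
  assumes "p \<in> ultras" "q \<in> ultras"
  shows "p \<boxplus> q \<in> ultras"
proof -
  have "{x. {y. x + y \<in> A \<inter> B} \<in> q} = {x. {y. x + y \<in> A} \<in> q} \<inter> {x. {y. x + y \<in> B} \<in> q}" for A B
    by (simp add: Collect_conj_eq ultra_Int[OF assms(2)])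
  then have "A \<inter> B \<in> p \<boxplus> q" if "A \<in> p \<boxplus> q" "B \<in> p \<boxplus> q" for A B
    using that by (simp add: mem_ultra_plus ultra_Int[OF assms(1)])
  moreover have "{x. {y. x + y \<in> - A} \<in> q} = - {x. {y. x + y \<in> A} \<in> q}" for A
    by (simp add: Collect_neg_eq ultra_Compl[OF assms(2)])
  then have "A \<in> p \<boxplus> q \<or> - A \<in> p \<boxplus> q" for A
    by (simp add: mem_ultra_plus ultra_Compl[OF assms(1)])
  moreover have "B \<in> p \<boxplus> q" if "A \<in> p \<boxplus> q" "A \<subseteq> B" for A B
  proof -
    have "{y. x + y \<in> B} \<in> q" if "{y. x + y \<in> A} \<in> q" for x
      using that \<open>A \<subseteq> B\<close> by (elim ultra_mono[OF assms(2)]) blast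
    then have "{x. {y. x + y \<in> A} \<in> q} \<subseteq> {x. {y. x + y \<in> B} \<in> q}" by blast
    then show ?thesis using that(1) ultra_mono[OF assms(1)] by (simp add: mem_ultra_plus)
  qed
  moreover have "UNIV \<in> p \<boxplus> q" "{} \<notin> p \<boxplus> q"
    using assms by (simp_all add: ultras_iff mem_ultra_plus)
  ultimately show ?thesis
    unfolding ultras_iff by blast
qed

lemma ultra_plus_assoc: "(p \<boxplus> q) \<boxplus> r = p \<boxplus> (q \<boxplus> r)" for p :: "'a::semigroup_add set set"
  by (simp add: ultra_add_def add.assoc)

lemma ultra_plus_superset:
  assumes "p \<in> ultras" "q \<in> ultras" "A \<in> p" "B \<in> q" "\<And>x y. x \<in> A \<Longrightarrow> y \<in> B \<Longrightarrow> x + y \<in> D"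
  shows "D \<in> p \<boxplus> q"
proof -
  have "{y. x + y \<in> D} \<in> q" if "x \<in> A" for x
    using assms(5)[OF that] by (intro ultra_mono[OF assms(2,4)]) blast
  then show ?thesis
    unfolding mem_ultra_plus by (intro ultra_mono[OF assms(1,3)]) blast
qed

definition image_ultra :: "('a \<Rightarrow> 'b) \<Rightarrow> 'a set set \<Rightarrow> 'b set set" where
  "image_ultra f p = {B. f -` B \<in> p}"

lemma image_ultra_closed: "p \<in> ultras \<Longrightarrow> image_ultra f p \<in> ultras"
  unfolding ultras_iff image_ultra_def
  by (auto simp: vimage_Compl) (meson vimage_mono)

lemma image_ultra_memI:
  assumes "p \<in> ultras" "A \<in> p" "\<And>x. x \<in> A \<Longrightarrow> f x \<in> B"
  shows "B \<in> image_ultra f p"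
  using assms ultra_mono[of p A "f -` B"] by (auto simp: image_ultra_def)

lemma image_ultra_plus:
  assumes "\<And>x y. f (x + y) = f x + f y"
  shows "image_ultra f (p \<boxplus> q) = image_ultra f p \<boxplus> image_ultra f q"
  by (simp add: image_ultra_def ultra_add_def vimage_def assms)

lemma image_ultra_comp: "image_ultra f (image_ultra g p) = image_ultra (f \<circ> g) p"
  by (simp add: image_ultra_def vimage_comp)

lemma image_ultra_id: "(\<And>x. f x = x) \<Longrightarrow> image_ultra f p = p"
  by (simp add: image_ultra_def vimage_def)

lemma image_ultra_cong:
  assumes "p \<in> ultras" "A \<in> p" "\<And>x. x \<in> A \<Longrightarrow> f x = g x"
  shows "image_ultra f p = image_ultra g p"
proof -
  have "f -` B \<in> p \<longleftrightarrow> g -` B \<in> p" for B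
  proof -
    have "f -` B \<inter> A = g -` B \<inter> A" using assms(3) by auto
    then show ?thesis using ultra_Int[OF assms(1)] assms(2) by metis
  qed
  then show ?thesis by (simp add: image_ultra_def)
qed

definition principal :: "'a \<Rightarrow> 'a set set" where
  "principal a = {A. a \<in> A}"

lemma principal_ultra: "principal a \<in> ultras"
  by (auto simp: ultras_iff principal_def)

lemma principal_zero_plus:
  fixes p :: "'a::monoid_add set set"
  shows "principal 0 \<boxplus> p = p" and "p \<boxplus> principal 0 = p"
  by (simp_all add: ultra_add_def principal_def)

lemma image_ultra_const:
  assumes "p \<in> ultras" shows "image_ultra (\<lambda>_. a) p = principal a"
  using assms by (auto simp: image_ultra_def principal_def ultras_iff vimage_def)

text \<open>Zorn's lemma: a maximal family with the finite intersection property is an ultrafilter.\<close>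

lemma ultrafilter_extends:
  fixes F :: "'a set set"
  assumes "F \<noteq> {}" "{} \<notin> F" "\<And>A B. A \<in> F \<Longrightarrow> B \<in> F \<Longrightarrow> A \<inter> B \<in> F"
  shows "\<exists>p\<in>ultras. F \<subseteq> p"
proof -
  let ?G = "{G. F \<subseteq> G \<and> {} \<notin> G \<and> (\<forall>A\<in>G. \<forall>B\<in>G. A \<inter> B \<in> G)}"
  have "\<exists>M\<in>?G. \<forall>X\<in>?G. M \<subseteq> X \<longrightarrow> X = M"
  proof (rule subset_Zorn_nonempty)
    show "?G \<noteq> {}" using assms by blast
    fix \<C> assume ne: "\<C> \<noteq> {}" and ch: "subset.chain ?G \<C>"
    have sub: "\<C> \<subseteq> ?G" and tot: "\<And>X Y. X \<in> \<C> \<Longrightarrow> Y \<in> \<C> \<Longrightarrow> X \<subseteq> Y \<or> Y \<subseteq> X"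
      using ch by (auto simp: subset.chain_def)
    have "A \<inter> B \<in> \<Union>\<C>" if "A \<in> \<Union>\<C>" "B \<in> \<Union>\<C>" for A B
    proof -
      from that obtain X Y where "A \<in> X" "X \<in> \<C>" "B \<in> Y" "Y \<in> \<C>" by auto
      then obtain Z where "A \<in> Z" "B \<in> Z" "Z \<in> \<C>" using tot[of X Y] by blast
      moreover from this have "A \<inter> B \<in> Z" using sub by auto
      ultimately show ?thesis by blast
    qed
    moreover obtain X where "X \<in> \<C>" using ne by blast
    then have "F \<subseteq> \<Union>\<C>" using sub by blast
    moreover have "{} \<notin> \<Union>\<C>" using sub by auto
    ultimately show "\<Union>\<C> \<in> ?G" by simp
  qed
  then obtain M where M: "M \<in> ?G" and max: "\<forall>X\<in>?G. M \<subseteq> X \<longrightarrow> X = M"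
    by (elim bexE)
  have FM: "F \<subseteq> M" and eM: "{} \<notin> M" and IM: "\<And>A B. A \<in> M \<Longrightarrow> B \<in> M \<Longrightarrow> A \<inter> B \<in> M"
    using M by auto
  obtain A0 where A0: "A0 \<in> M" using assms(1) FM by blast
  have add: "A \<in> M" if "\<And>D. D \<in> M \<Longrightarrow> D \<inter> A \<noteq> {}" for A
  proof -
    let ?X = "{B. \<exists>D\<in>M. D \<inter> A \<subseteq> B}"
    have "M \<subseteq> ?X" by blast
    moreover have "{} \<notin> ?X" using that by blast
    moreover have "B \<inter> B' \<in> ?X" if "B \<in> ?X" "B' \<in> ?X" for B B'
    proof -
      from that obtain D D' where D: "D \<in> M" "D' \<in> M" "D \<inter> A \<subseteq> B" "D' \<inter> A \<subseteq> B'" by blast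
      then have "D \<inter> D' \<in> M" "(D \<inter> D') \<inter> A \<subseteq> B \<inter> B'" using IM by auto
      then show ?thesis by blast
    qed
    ultimately have "?X \<in> ?G" "M \<subseteq> ?X" using FM by auto
    then have "?X = M" using bspec[OF max, of ?X] by simp
    then show ?thesis using A0 by blast
  qed
  have up: "B \<in> M" if "A \<in> M" "A \<subseteq> B" for A B
  proof (rule add)
    fix D assume "D \<in> M"
    then have "D \<inter> A \<in> M" using IM that(1) by blast
    then have "D \<inter> A \<noteq> {}" using eM by auto
    then show "D \<inter> B \<noteq> {}" using that(2) by blast
  qed
  have "M \<in> ultras"
    unfolding ultras_iff
  proof (intro conjI)
    show "UNIV \<in> M" by (rule up[OF A0 subset_UNIV])
    show "\<forall>A\<in>M. \<forall>B. A \<subseteq> B \<longrightarrow> B \<in> M"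
    proof (intro ballI allI impI)
      fix A B assume "A \<in> M" "A \<subseteq> B"
      then show "B \<in> M" by (rule up)
    qed
    show "\<forall>A. A \<in> M \<or> - A \<in> M"
    proof
      fix A
      have "- A \<in> M" if "A \<notin> M"
      proof -
        have "\<exists>D\<in>M. D \<inter> A = {}"
        proof (rule ccontr)
          assume "\<not> (\<exists>D\<in>M. D \<inter> A = {})"
          then have "A \<in> M" by (intro add) auto
          then show False using that by contradiction
        qed
        then obtain D where "D \<in> M" "D \<inter> A = {}" by auto
        then show ?thesis by (intro up[of D "- A"]) auto
      qed
      then show "A \<in> M \<or> - A \<in> M" by blast
    qed
  qed (use eM IM in auto)
  then show ?thesis using FM by blast
qed

text \<open>Closed sets of ultrafilters correspond to filters: the filter of a set \<open>X\<close> of ultrafilters is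
  \<open>\<Inter>X\<close>, and the ultrafilters that extend it form the closure of \<open>X\<close>. Everything needed about the
  topology of the Stone-Cech compactification is expressed in these terms.\<close>

definition closed_ultras :: "'a set set set \<Rightarrow> bool" where
  "closed_ultras X \<longleftrightarrow> X \<subseteq> ultras \<and> (\<forall>p\<in>ultras. \<Inter>X \<subseteq> p \<longrightarrow> p \<in> X)"

lemma closed_ultras_containing: "closed_ultras {p\<in>ultras. \<A> \<subseteq> p}"
  unfolding closed_ultras_def by blast

lemma closed_ultras_Inter:
  assumes "\<C> \<noteq> {}" "\<And>X. X \<in> \<C> \<Longrightarrow> closed_ultras X"
  shows "closed_ultras (\<Inter>\<C>)"
proof -
  have "p \<in> X" if "p \<in> ultras" "\<Inter>(\<Inter>\<C>) \<subseteq> p" "X \<in> \<C>" for p X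
  proof -
    have "\<Inter>X \<subseteq> \<Inter>(\<Inter>\<C>)" using that(3) by blast
    then show ?thesis using assms(2)[OF that(3)] that by (auto simp: closed_ultras_def)
  qed
  moreover have "\<Inter>\<C> \<subseteq> ultras" using assms by (fastforce simp: closed_ultras_def)
  ultimately show ?thesis unfolding closed_ultras_def by blast
qed

text \<open>Compactness, in the form in which Zorn's lemma uses it: the filters of a chain of closed sets
  again form a chain, so that their union is a filter and extends to an ultrafilter.\<close>

lemma closed_ultras_chain:
  assumes "\<C> \<noteq> {}" "\<And>X. X \<in> \<C> \<Longrightarrow> closed_ultras X \<and> X \<noteq> {}"
    and chain: "\<And>X Y. X \<in> \<C> \<Longrightarrow> Y \<in> \<C> \<Longrightarrow> X \<subseteq> Y \<or> Y \<subseteq> X"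
  shows "\<Inter>\<C> \<noteq> {}"
proof -
  let ?F = "\<Union>X\<in>\<C>. \<Inter>X"
  have uX: "X \<subseteq> ultras" if "X \<in> \<C>" for X using assms(2)[OF that] by (simp add: closed_ultras_def)
  have "\<exists>p\<in>ultras. ?F \<subseteq> p"
  proof (rule ultrafilter_extends)
    show "?F \<noteq> {}" using assms(1) uX ultra_UNIV by blast
    show "{} \<notin> ?F" using assms(2) uX ultra_nonempty by blast
    fix A B assume "A \<in> ?F" "B \<in> ?F"
    then obtain X Y where "X \<in> \<C>" "A \<in> \<Inter>X" "Y \<in> \<C>" "B \<in> \<Inter>Y" by blast
    then obtain Z where Z: "Z \<in> \<C>" "A \<in> \<Inter>Z" "B \<in> \<Inter>Z" using chain[of X Y] by blast
    then have "A \<inter> B \<in> \<Inter>Z" using uX[OF Z(1)] ultra_Int by blast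
    then show "A \<inter> B \<in> ?F" using Z by blast
  qed
  then obtain p where "p \<in> ultras" "?F \<subseteq> p" by blast
  then have "p \<in> X" if "X \<in> \<C>" for X
    using that assms(2)[OF that] unfolding closed_ultras_def by blast
  then show ?thesis by blast
qed

lemma minimal_closed_ultras:
  assumes X: "closed_ultras X" "X \<noteq> {}" "P X"
    and inter: "\<And>\<C>. \<C> \<noteq> {} \<Longrightarrow> (\<And>Y. Y \<in> \<C> \<Longrightarrow> P Y) \<Longrightarrow> P (\<Inter>\<C>)"
  obtains Y where "closed_ultras Y" "Y \<noteq> {}" "P Y" "Y \<subseteq> X"
    "\<And>Z. closed_ultras Z \<Longrightarrow> Z \<noteq> {} \<Longrightarrow> P Z \<Longrightarrow> Z \<subseteq> Y \<Longrightarrow> Z = Y"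
proof -
  let ?A = "{Y. closed_ultras Y \<and> Y \<noteq> {} \<and> P Y \<and> Y \<subseteq> X}"
  have "\<exists>m\<in>?A. \<forall>a\<in>?A. m \<supseteq> a \<longrightarrow> a = m"
  proof (rule predicate_Zorn)
    show "partial_order_on ?A (relation_of (\<lambda>Y Z. Z \<subseteq> Y) ?A)"
      by (rule partial_order_on_relation_ofI) auto
    fix \<C> assume C: "\<C> \<in> Chains (relation_of (\<lambda>Y Z. Z \<subseteq> Y) ?A)"
    show "\<exists>u\<in>?A. \<forall>a\<in>\<C>. u \<subseteq> a"
    proof (cases "\<C> = {}")
      case True then show ?thesis using X by blast
    next
      case False
      have sub: "\<C> \<subseteq> ?A" by (rule Chains_relation_of[OF C])
      have "X \<subseteq> Y \<or> Y \<subseteq> X" if "X \<in> \<C>" "Y \<in> \<C>" for X Y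
        using C that unfolding Chains_def relation_of_def by blast
      then have "\<Inter>\<C> \<noteq> {}" using closed_ultras_chain[OF False] sub by blast
      moreover have "closed_ultras (\<Inter>\<C>)" using closed_ultras_Inter[OF False] sub by blast
      moreover have "P (\<Inter>\<C>)" using inter[OF False] sub by blast
      moreover have "\<Inter>\<C> \<subseteq> X" using False sub by blast
      ultimately show ?thesis by blast
    qed
  qed
  then obtain Y where Y: "Y \<in> ?A" and min: "\<forall>Z\<in>?A. Z \<subseteq> Y \<longrightarrow> Z = Y"
    by (elim bexE)
  show thesis
  proof (rule that)
    fix Z assume "closed_ultras Z" "Z \<noteq> {}" "P Z" "Z \<subseteq> Y"
    then show "Z = Y" using bspec[OF min, of Z] Y by auto
  qed (use Y in simp_all)
qed

text \<open>Right translations are continuous, because \<open>B \<in> p \<boxplus> q\<close> is the membership in \<open>p\<close> of a set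
  that depends on \<open>B\<close> and \<open>q\<close> only. Hence preimages of closed sets are closed, and by compactness so
  are images.\<close>

lemma closed_ultras_translate:
  assumes X: "closed_ultras X" and q: "q \<in> ultras"
  shows "closed_ultras ((\<lambda>p. p \<boxplus> q) ` X)"
proof -
  have uX: "X \<subseteq> ultras" using X by (simp add: closed_ultras_def)
  have "r \<in> (\<lambda>p. p \<boxplus> q) ` X" if r: "r \<in> ultras" and sub: "\<Inter>((\<lambda>p. p \<boxplus> q) ` X) \<subseteq> r" for r
  proof -
    let ?T = "\<lambda>B. {x. {y. x + y \<in> B} \<in> q}"
    have Tint: "?T (B \<inter> B') = ?T B \<inter> ?T B'" for B B'
      by (simp add: Collect_conj_eq ultra_Int[OF q])
    let ?F = "{A \<inter> ?T B |A B. A \<in> \<Inter>X \<and> B \<in> r}"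
    have UT: "?T UNIV = UNIV" using ultra_UNIV[OF q] by simp
    have UX: "UNIV \<in> \<Inter>X" using uX ultra_UNIV by blast
    have "\<exists>p\<in>ultras. ?F \<subseteq> p"
    proof (rule ultrafilter_extends)
      show "?F \<noteq> {}" using ultra_UNIV[OF r] UX by blast
      show "{} \<notin> ?F"
      proof
        assume "{} \<in> ?F"
        then obtain A B where AB: "A \<in> \<Inter>X" "B \<in> r" "A \<inter> ?T B = {}" by blast
        have "- B \<in> p \<boxplus> q" if p: "p \<in> X" for p
        proof -
          have pu: "p \<in> ultras" and "A \<in> p" using p uX AB(1) by auto
          have "{} \<notin> p" using ultra_nonempty[OF pu] by auto
          then have "?T B \<notin> p" using ultra_Int[OF pu, of A "?T B"] AB(3) \<open>A \<in> p\<close> by simp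
          then have "B \<notin> p \<boxplus> q" by (simp add: mem_ultra_plus)
          then show ?thesis using ultra_Compl[OF ultra_plus_closed[OF pu q]] by simp
        qed
        then have "- B \<in> r" using subsetD[OF sub, of "- B"] by auto
        then show False using AB(2) ultra_Compl[OF r] by simp
      qed
      fix C D assume "C \<in> ?F" "D \<in> ?F"
      then obtain A B A' B' where *: "C = A \<inter> ?T B" "D = A' \<inter> ?T B'"
        "A \<in> \<Inter>X" "A' \<in> \<Inter>X" "B \<in> r" "B' \<in> r" by blast
      have "C \<inter> D = (A \<inter> A') \<inter> ?T (B \<inter> B')" unfolding Tint * by blast
      moreover have "A \<inter> A' \<in> \<Inter>X"
      proof
        fix p assume p: "p \<in> X"
        then have "p \<in> ultras" "A \<in> p" "A' \<in> p" using uX * by auto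
        then show "A \<inter> A' \<in> p" by (simp add: ultra_Int)
      qed
      moreover have "B \<inter> B' \<in> r" using * ultra_Int[OF r] by simp
      ultimately show "C \<inter> D \<in> ?F" by blast
    qed
    then obtain p where p: "p \<in> ultras" "?F \<subseteq> p" by blast
    have "A \<in> p" if "A \<in> \<Inter>X" for A
    proof -
      have "A \<inter> ?T UNIV \<in> ?F" using that ultra_UNIV[OF r] by blast
      then show ?thesis using p(2) unfolding UT by auto
    qed
    then have pX: "p \<in> X" using X p(1) unfolding closed_ultras_def by blast
    have "B \<in> p \<boxplus> q" if "B \<in> r" for B
    proof -
      have "UNIV \<inter> ?T B \<in> ?F" using that UX by blast
      then show ?thesis using p(2) unfolding mem_ultra_plus by auto
    qed
    then have "r = p \<boxplus> q" using ultra_eqI[OF r ultra_plus_closed[OF p(1) q]] by blast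
    then show ?thesis using pX by blast
  qed
  then show ?thesis using uX ultra_plus_closed[OF _ q] unfolding closed_ultras_def by blast
qed

lemma closed_ultras_translate_vimage:
  assumes X: "closed_ultras X" and Y: "closed_ultras Y" and q: "q \<in> ultras"
  shows "closed_ultras {p\<in>X. p \<boxplus> q \<in> Y}"
  unfolding closed_ultras_def
proof (intro conjI ballI impI)
  show "{p \<in> X. p \<boxplus> q \<in> Y} \<subseteq> ultras" using X by (auto simp: closed_ultras_def)
  fix r assume r: "r \<in> ultras" and sub: "\<Inter>{p \<in> X. p \<boxplus> q \<in> Y} \<subseteq> r"
  have "\<Inter>X \<subseteq> r" using sub by blast
  then have "r \<in> X" using X r by (simp add: closed_ultras_def)
  moreover have "\<Inter>Y \<subseteq> r \<boxplus> q"
  proof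
    fix B assume "B \<in> \<Inter>Y"
    then have "{x. {y. x + y \<in> B} \<in> q} \<in> \<Inter>{p \<in> X. p \<boxplus> q \<in> Y}" by (auto simp flip: mem_ultra_plus)
    then show "B \<in> r \<boxplus> q" using sub by (auto simp: mem_ultra_plus)
  qed
  then have "r \<boxplus> q \<in> Y" using Y ultra_plus_closed[OF r q] by (simp add: closed_ultras_def)
  ultimately show "r \<in> {p \<in> X. p \<boxplus> q \<in> Y}" by blast
qed

section \<open>Idempotents and minimal left ideals\<close>

text \<open>Ellis: in a minimal closed subsemigroup \<open>Y\<close> and for \<open>e \<in> Y\<close>, both \<open>Y \<boxplus> e\<close> and the set of
  the \<open>p \<in> Y\<close> with \<open>p \<boxplus> e = e\<close> are closed subsemigroups, hence equal to \<open>Y\<close>.\<close>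

lemma idempotent_exists:
  fixes X :: "'a::semigroup_add set set set"
  assumes X: "closed_ultras X" "X \<noteq> {}" and semi: "\<And>p q. p \<in> X \<Longrightarrow> q \<in> X \<Longrightarrow> p \<boxplus> q \<in> X"
  obtains e where "e \<in> X" "e \<boxplus> e = e"
proof -
  obtain Y where Y: "closed_ultras Y" "Y \<noteq> {}" "\<forall>p\<in>Y. \<forall>q\<in>Y. p \<boxplus> q \<in> Y" "Y \<subseteq> X"
    and min: "\<And>Z. closed_ultras Z \<Longrightarrow> Z \<noteq> {} \<Longrightarrow> \<forall>p\<in>Z. \<forall>q\<in>Z. p \<boxplus> q \<in> Z \<Longrightarrow> Z \<subseteq> Y \<Longrightarrow> Z = Y"
    by (rule minimal_closed_ultras[OF X, where P = "\<lambda>Y. \<forall>p\<in>Y. \<forall>q\<in>Y. p \<boxplus> q \<in> Y"])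
      (use semi in auto)
  obtain e where e: "e \<in> Y" using Y(2) by blast
  have uY: "Y \<subseteq> ultras" using Y(1) by (simp add: closed_ultras_def)
  have eu: "e \<in> ultras" using e uY by blast
  have sub: "(\<lambda>p. p \<boxplus> e) ` Y \<subseteq> Y" using Y(3) e by blast
  have "(p \<boxplus> e) \<boxplus> (q \<boxplus> e) \<in> (\<lambda>p. p \<boxplus> e) ` Y" if "p \<in> Y" "q \<in> Y" for p q
  proof -
    have "(p \<boxplus> e) \<boxplus> (q \<boxplus> e) = (p \<boxplus> (e \<boxplus> q)) \<boxplus> e" by (simp add: ultra_plus_assoc)
    then show ?thesis using that e Y(3) by blast
  qed
  then have "(\<lambda>p. p \<boxplus> e) ` Y = Y"
    using closed_ultras_translate[OF Y(1) eu] Y(2) sub by (intro min) blast+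
  then have "e \<in> (\<lambda>p. p \<boxplus> e) ` Y" using e by simp
  then obtain f where f: "f \<in> Y" "f \<boxplus> e = e" by auto
  let ?Z = "{p\<in>Y. p \<boxplus> e \<in> {e}}"
  have ce: "closed_ultras {e}"
    unfolding closed_ultras_def using eu ultra_eqI[OF eu] by auto
  have "?Z = Y"
  proof (rule min)
    show "closed_ultras ?Z" by (rule closed_ultras_translate_vimage[OF Y(1) ce eu])
    show "?Z \<noteq> {}" using f by blast
    show "\<forall>p\<in>?Z. \<forall>q\<in>?Z. p \<boxplus> q \<in> ?Z" using Y(3) by (simp add: ultra_plus_assoc)
  qed blast
  then have "e \<boxplus> e = e" using e by blast
  then show thesis using that e Y(4) by blast
qed

text \<open>These are the elements of the minimal left ideals of \<open>X\<close>: an element \<open>p\<close> lies in such an ideal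
  exactly if every left ideal \<open>X \<boxplus> (t \<boxplus> p)\<close> still contains \<open>p\<close>.\<close>

definition left_minimal :: "'a::plus set set set \<Rightarrow> 'a set set set" where
  "left_minimal X = {p\<in>X. \<forall>t\<in>X. \<exists>s\<in>X. s \<boxplus> (t \<boxplus> p) = p}"

text \<open>Only the existence of a left minimal element needs compactness: a minimal closed left ideal
  \<open>L\<close> equals \<open>X \<boxplus> p\<close> for each \<open>p \<in> L\<close>.\<close>

lemma left_minimal_ideal:
  fixes X :: "'a::semigroup_add set set set"
  assumes X: "closed_ultras X" "X \<noteq> {}" and semi: "\<And>p q. p \<in> X \<Longrightarrow> q \<in> X \<Longrightarrow> p \<boxplus> q \<in> X"
  shows "two_sided_ideal (\<boxplus>) X (left_minimal X)"
proof -
  obtain L where L: "closed_ultras L" "L \<noteq> {}" "\<forall>t\<in>X. \<forall>p\<in>L. t \<boxplus> p \<in> L" "L \<subseteq> X"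
    and min: "\<And>Z. closed_ultras Z \<Longrightarrow> Z \<noteq> {} \<Longrightarrow> \<forall>t\<in>X. \<forall>p\<in>Z. t \<boxplus> p \<in> Z \<Longrightarrow> Z \<subseteq> L \<Longrightarrow> Z = L"
    by (rule minimal_closed_ultras[OF X, where P = "\<lambda>Y. \<forall>t\<in>X. \<forall>p\<in>Y. t \<boxplus> p \<in> Y"])
      (use semi in auto)
  have uX: "X \<subseteq> ultras" using X(1) by (simp add: closed_ultras_def)
  have XL: "(\<lambda>t. t \<boxplus> p) ` X = L" if p: "p \<in> L" for p
  proof (rule min)
    have "p \<in> ultras" using p L(4) uX by blast
    then show "closed_ultras ((\<lambda>t. t \<boxplus> p) ` X)" by (rule closed_ultras_translate[OF X(1)])
    show "\<forall>t\<in>X. \<forall>r\<in>(\<lambda>t. t \<boxplus> p) ` X. t \<boxplus> r \<in> (\<lambda>t. t \<boxplus> p) ` X"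
      using semi by (auto simp flip: ultra_plus_assoc)
  qed (use X(2) L(3) p in auto)
  have "\<exists>s\<in>X. s \<boxplus> (t \<boxplus> p) = p" if "p \<in> L" "t \<in> X" for p t
  proof -
    have "p \<in> (\<lambda>s. s \<boxplus> (t \<boxplus> p)) ` X" using XL[of "t \<boxplus> p"] L(3) that by blast
    then show ?thesis by auto
  qed
  then have "L \<subseteq> left_minimal X" unfolding left_minimal_def using L(4) by blast
  then have ne: "left_minimal X \<noteq> {}" using L(2) by blast
  have "u \<boxplus> p \<in> left_minimal X" if u: "u \<in> X" and p: "p \<in> left_minimal X" for u p
    unfolding left_minimal_def
  proof (intro CollectI conjI ballI)
    show "u \<boxplus> p \<in> X" using u p semi by (simp add: left_minimal_def)
    fix t assume "t \<in> X"
    then obtain s where "s \<in> X" "s \<boxplus> ((t \<boxplus> u) \<boxplus> p) = p" using semi u p unfolding left_minimal_def by blast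
    then have "(u \<boxplus> s) \<boxplus> (t \<boxplus> (u \<boxplus> p)) = u \<boxplus> p" "u \<boxplus> s \<in> X" using semi u by (simp_all add: ultra_plus_assoc)
    then show "\<exists>s\<in>X. s \<boxplus> (t \<boxplus> (u \<boxplus> p)) = u \<boxplus> p" by blast
  qed
  moreover have "p \<boxplus> u \<in> left_minimal X" if u: "u \<in> X" and p: "p \<in> left_minimal X" for u p
    unfolding left_minimal_def
  proof (intro CollectI conjI ballI)
    show "p \<boxplus> u \<in> X" using u p semi by (simp add: left_minimal_def)
    fix t assume "t \<in> X"
    then obtain s where "s \<in> X" "s \<boxplus> (t \<boxplus> p) = p" using p unfolding left_minimal_def by blast
    then show "\<exists>s\<in>X. s \<boxplus> (t \<boxplus> (p \<boxplus> u)) = p \<boxplus> u" by (metis ultra_plus_assoc)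
  qed
  moreover have "left_minimal X \<subseteq> X" by (auto simp: left_minimal_def)
  ultimately show ?thesis unfolding two_sided_ideal_def using ne by simp
qed

text \<open>Since \<open>p\<close> is a left multiple of \<open>f\<close>, the idempotent \<open>f\<close> is a right identity for it. Minimality
  enters the construction of solutions in this form.\<close>

lemma left_minimal_absorbs:
  fixes X :: "'a::semigroup_add set set set"
  assumes "p \<in> left_minimal X" "t \<in> X" "f = t \<boxplus> p" "f \<boxplus> f = f"
  shows "p \<boxplus> f = p"
proof -
  obtain s where "s \<boxplus> f = p" using assms(1,2) unfolding left_minimal_def assms(3) by auto
  then show ?thesis using assms(4) by (metis ultra_plus_assoc)
qed

section \<open>Minimal idempotents near zero\<close>

text \<open>The form of this definition shows that the set is closed.\<close>

definition near_zero_ultras :: "real set \<Rightarrow> real set set set" where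
  "near_zero_ultras S = {p\<in>ultras. (\<lambda>\<epsilon>. {0<..<\<epsilon>} \<inter> S) ` {0<..} \<subseteq> p}"

lemma near_zero_ultras_iff:
  "p \<in> near_zero_ultras S \<longleftrightarrow> p \<in> ultras \<and> (\<forall>\<epsilon>>0. {0<..<\<epsilon>} \<inter> S \<in> p)"
  by (auto simp: near_zero_ultras_def)

lemma near_zero_ultras_plus:
  assumes S: "\<And>x y. x \<in> S \<Longrightarrow> y \<in> S \<Longrightarrow> x + y \<in> S"
    and p: "p \<in> near_zero_ultras S" and q: "q \<in> near_zero_ultras S"
  shows "p \<boxplus> q \<in> near_zero_ultras S"
  unfolding near_zero_ultras_iff
proof (intro conjI allI impI)
  have u: "p \<in> ultras" "q \<in> ultras" using p q by (simp_all add: near_zero_ultras_iff)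
  show "p \<boxplus> q \<in> ultras" by (rule ultra_plus_closed[OF u])
  fix \<epsilon> :: real assume "0 < \<epsilon>"
  then have "{0<..<\<epsilon>/2} \<inter> S \<in> p" "{0<..<\<epsilon>/2} \<inter> S \<in> q"
    using p q by (simp_all add: near_zero_ultras_iff)
  then show "{0<..<\<epsilon>} \<inter> S \<in> p \<boxplus> q"
    by (rule ultra_plus_superset[OF u]) (auto intro: S)
qed

text \<open>An ultrafilter on \<open>S\<close> is the trace of an ultrafilter on the whole type that contains \<open>S\<close>, and
  taking traces is an isomorphism. So every ultrafilter of vectors or numbers below can live on a full
  type. The left minimal elements form an ideal, whose traces contain the smallest ideal. The
  points of \<open>S\<close> near zero ensure that there are ultrafilters near zero at all; otherwise there would
  be no ideal, and the intersection of all ideals would contain everything.\<close>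

lemma minimal_idempotent_extends:
  assumes S: "\<And>x y. x \<in> S \<Longrightarrow> y \<in> S \<Longrightarrow> x + y \<in> S"
    and small: "\<And>\<epsilon>. \<epsilon> > 0 \<Longrightarrow> {0<..<\<epsilon>} \<inter> S \<noteq> {}"
    and p: "minimal_idempotent_near_zero S p"
  obtains P where "P \<in> left_minimal (near_zero_ultras S)" "P \<boxplus> P = P" "p = P \<inter> Pow S"
proof -
  let ?T = "near_zero_ultras S"
  define r :: "real set set \<Rightarrow> real set set" where "r P = P \<inter> Pow S" for P
  have mem_r: "A \<in> r P \<longleftrightarrow> A \<in> P \<and> A \<subseteq> S" for A P by (auto simp: r_def)
  have S_in: "S \<in> P" if "P \<in> ?T" for P
  proof -
    have "{0<..<1} \<inter> S \<in> P" "P \<in> ultras" using that by (simp_all add: near_zero_ultras_iff)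
    then show ?thesis using ultra_mono by blast
  qed
  have r_plus: "r (P \<boxplus> Q) = ultra_add S (r P) (r Q)" if "P \<in> ?T" "Q \<in> ?T" for P Q
  proof -
    have u: "P \<in> ultras" "Q \<in> ultras" using that by (simp_all add: near_zero_ultras_iff)
    have "{x \<in> S. {y \<in> S. x + y \<in> B} \<in> r Q} \<in> r P \<longleftrightarrow> B \<in> P \<boxplus> Q" for B
    proof -
      have "{y \<in> S. x + y \<in> B} \<in> r Q \<longleftrightarrow> {y. x + y \<in> B} \<in> Q" for x
        using ultra_Int[OF u(2), of S "{y. x + y \<in> B}"] S_in[OF that(2)]
        by (simp add: mem_r Collect_conj_eq)
      then show ?thesis
        using ultra_Int[OF u(1), of S "{x. {y. x + y \<in> B} \<in> Q}"] S_in[OF that(1)]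
        by (simp add: mem_r Collect_conj_eq mem_ultra_plus)
    qed
    then have "B \<in> ultra_add S (r P) (r Q) \<longleftrightarrow> B \<in> r (P \<boxplus> Q)" for B
      unfolding ultra_add_def[of S] mem_r[of B "P \<boxplus> Q"] by auto
    then show ?thesis by auto
  qed
  have r_zero: "r P \<in> zero_plus S" if "P \<in> ?T" for P
  proof -
    have u: "P \<in> ultras" using that by (simp add: near_zero_ultras_iff)
    have "A \<in> P \<or> S - A \<in> P" for A
      using ultra_Compl[OF u, of A] ultra_Int[OF u, of S "- A"] S_in[OF that] by (auto simp: Diff_eq)
    moreover have "{} \<notin> P" using ultra_nonempty[OF u] by auto
    ultimately have "r P \<in> stone_cech S"
      unfolding stone_cech_def using u S_in[OF that]
      by (auto simp: mem_r ultra_Int intro: ultra_mono[OF u])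
    then show ?thesis using that by (simp add: zero_plus_def mem_r near_zero_ultras_iff)
  qed
  have r_surj: "\<exists>P\<in>?T. r P = q" if q: "q \<in> zero_plus S" for q
  proof -
    define Q where "Q = {A. A \<inter> S \<in> q}"
    have q': "q \<subseteq> Pow S" "S \<in> q" "{} \<notin> q" "\<And>A B. A \<in> q \<Longrightarrow> B \<in> q \<Longrightarrow> A \<inter> B \<in> q"
      "\<And>A B. A \<in> q \<Longrightarrow> A \<subseteq> B \<Longrightarrow> B \<subseteq> S \<Longrightarrow> B \<in> q" "\<And>A. A \<subseteq> S \<Longrightarrow> A \<in> q \<or> S - A \<in> q"
      "\<And>\<epsilon>. \<epsilon> > 0 \<Longrightarrow> {0<..<\<epsilon>} \<inter> S \<in> q"
      using q unfolding zero_plus_def stone_cech_def by auto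
    have "Q \<in> ultras"
      unfolding ultras_iff
    proof (intro conjI ballI allI impI)
      fix A B assume "A \<in> Q" "B \<in> Q"
      then have "(A \<inter> S) \<inter> (B \<inter> S) \<in> q" unfolding Q_def using q'(4)[of "A \<inter> S" "B \<inter> S"] by simp
      moreover have "(A \<inter> S) \<inter> (B \<inter> S) = A \<inter> B \<inter> S" by blast
      ultimately show "A \<inter> B \<in> Q" unfolding Q_def by simp
    next
      fix A B assume "A \<in> Q" "A \<subseteq> B"
      then show "B \<in> Q" unfolding Q_def using q'(5)[of "A \<inter> S" "B \<inter> S"] by auto
    next
      fix A
      have "- A \<inter> S = S - (A \<inter> S)" by blast
      then show "A \<in> Q \<or> - A \<in> Q" unfolding Q_def using q'(6)[of "A \<inter> S"] by auto
    qed (use q'(2,3) in \<open>simp_all add: Q_def\<close>)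
    moreover have "r Q = q"
      using q'(1) by (auto simp: mem_r Q_def inf.absorb1)
    moreover have "{0<..<\<epsilon>} \<inter> S \<in> Q" if "\<epsilon> > 0" for \<epsilon>
      using q'(7)[OF that] by (simp add: Q_def)
    ultimately have "Q \<in> ?T" "r Q = q" by (simp_all add: near_zero_ultras_iff)
    then show ?thesis by (intro bexI[of _ Q])
  qed
  have r_inj: "P = Q" if "P \<in> ?T" "Q \<in> ?T" "r P = r Q" for P Q
  proof (rule ultra_eqI)
    show u: "P \<in> ultras" "Q \<in> ultras" using that by (simp_all add: near_zero_ultras_iff)
    show "P \<subseteq> Q"
    proof
      fix A assume "A \<in> P"
      then have "A \<inter> S \<in> r P" using S_in[OF that(1)] by (simp add: mem_r ultra_Int[OF u(1)])
      then show "A \<in> Q" unfolding that(3) by (simp add: mem_r ultra_Int[OF u(2)])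
    qed
  qed
  have pK: "p \<in> smallest_ideal (ultra_add S) (zero_plus S)" and pp: "ultra_add S p p = p"
    using p by (simp_all add: minimal_idempotent_near_zero_def)
  have "\<exists>P\<in>ultras. (\<lambda>\<epsilon>. {0<..<\<epsilon>} \<inter> S) ` {0<..} \<subseteq> P"
  proof (rule ultrafilter_extends)
    show "{} \<notin> (\<lambda>\<epsilon>. {0<..<\<epsilon>} \<inter> S) ` {0<..}" using small by auto
    fix A B assume "A \<in> (\<lambda>\<epsilon>. {0<..<\<epsilon>} \<inter> S) ` {0<..}" "B \<in> (\<lambda>\<epsilon>. {0<..<\<epsilon>} \<inter> S) ` {0<..}"
    then obtain \<epsilon> \<delta> where "0 < \<epsilon>" "0 < \<delta>" "A = {0<..<\<epsilon>} \<inter> S" "B = {0<..<\<delta>} \<inter> S" by auto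
    then have "A \<inter> B = {0<..<min \<epsilon> \<delta>} \<inter> S" "0 < min \<epsilon> \<delta>" by auto
    then show "A \<inter> B \<in> (\<lambda>\<epsilon>. {0<..<\<epsilon>} \<inter> S) ` {0<..}" by blast
  qed auto
  then have "?T \<noteq> {}" by (auto simp: near_zero_ultras_def)
  moreover have "closed_ultras ?T"
    unfolding near_zero_ultras_def by (rule closed_ultras_containing)
  ultimately have K: "two_sided_ideal (\<boxplus>) ?T (left_minimal ?T)"
    using near_zero_ultras_plus[OF S] by (intro left_minimal_ideal)
  have "two_sided_ideal (ultra_add S) (zero_plus S) (r ` left_minimal ?T)"
    unfolding two_sided_ideal_def
  proof (intro conjI ballI)
    have lm: "left_minimal ?T \<noteq> {}" "left_minimal ?T \<subseteq> ?T"
      using K by (simp_all add: two_sided_ideal_def)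
    show "r ` left_minimal ?T \<noteq> {}" "r ` left_minimal ?T \<subseteq> zero_plus S"
      using lm r_zero by auto
    fix t x assume "t \<in> zero_plus S" "x \<in> r ` left_minimal ?T"
    then obtain t' x' where t': "t' \<in> ?T" "t = r t'" and x': "x' \<in> left_minimal ?T" "x = r x'"
      using r_surj[of t] by auto
    have "t' \<boxplus> x' \<in> left_minimal ?T" "x' \<boxplus> t' \<in> left_minimal ?T" "x' \<in> ?T"
      using K t'(1) x'(1) lm(2) unfolding two_sided_ideal_def by auto
    then show "ultra_add S t x \<in> r ` left_minimal ?T" "ultra_add S x t \<in> r ` left_minimal ?T"
      unfolding t'(2) x'(2) using t'(1) by (simp_all flip: r_plus)
  qed
  then have "p \<in> r ` left_minimal ?T" using pK unfolding smallest_ideal_def by blast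
  then obtain P where P: "P \<in> left_minimal ?T" "p = r P" by blast
  then have PT: "P \<in> ?T" by (simp add: left_minimal_def)
  have "r (P \<boxplus> P) = r P" unfolding r_plus[OF PT PT] using pp P(2) by simp
  moreover have "P \<boxplus> P \<in> ?T" by (rule near_zero_ultras_plus[OF _ PT PT]) (rule S)
  ultimately have "P \<boxplus> P = P" using r_inj PT by simp
  then show thesis by (rule that[OF P(1) _ P(2)[unfolded r_def]])
qed

section \<open>First entries matrices\<close>

lemma nat_combination_mem:
  fixes S :: "real set" and b :: "'i \<Rightarrow> nat"
  assumes S: "\<And>x y. x \<in> S \<Longrightarrow> y \<in> S \<Longrightarrow> x + y \<in> S" and "finite I"
    and "\<And>i. i \<in> I \<Longrightarrow> b i \<noteq> 0 \<Longrightarrow> y i \<in> S" and "\<exists>i\<in>I. b i \<noteq> 0"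
  shows "(\<Sum>i\<in>I. real (b i) * y i) \<in> S"
proof -
  have mult: "real (Suc n) * x \<in> S" if "x \<in> S" for n x
  proof (induction n)
    case (Suc n)
    have "real (Suc (Suc n)) * x = real (Suc n) * x + x" by (simp add: algebra_simps)
    then show ?case using S[OF Suc that] by simp
  qed (use that in simp)
  have "(\<forall>i\<in>I. b i = 0) \<or> (\<Sum>i\<in>I. real (b i) * y i) \<in> S"
    using assms(2,3)
  proof (induction I rule: finite_induct)
    case (insert a I)
    have IH: "(\<forall>i\<in>I. b i = 0) \<or> (\<Sum>i\<in>I. real (b i) * y i) \<in> S" using insert by blast
    show ?case
    proof (cases "b a")
      case 0
      then show ?thesis using IH insert(1,2) by simp
    next
      case (Suc n)
      then have "real (b a) * y a \<in> S" using mult insert.prems[of a] by simp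
      then show ?thesis using IH insert(1,2) S by auto
    qed
  qed simp
  then show ?thesis using assms(4) by auto
qed

text \<open>The columns are treated one at a time, from the last to the first, and the idempotent
  ultrafilter \<open>q\<close> of vectors is such that every row treated so far maps it to \<open>P\<close>. To add column
  \<open>k\<close>, let \<open>R\<close> be the closed semigroup of the ultrafilters of vectors near zero whose entry \<open>k\<close> is any
  element of \<open>S\<close> and whose remaining part is distributed according to \<open>q\<close>, and let \<open>P'\<close> be the copy of
  \<open>P\<close> in coordinate \<open>k\<close>, divided by the first entry. A row that starts in column \<open>k\<close> maps \<open>P'\<close> to
  \<open>P\<close>. Hence it maps an idempotent \<open>f \<in> R \<boxplus> P'\<close> to an idempotent left multiple of \<open>P\<close>, which \<open>P\<close>
  absorbs by minimality, and it maps \<open>P' \<boxplus> f\<close> to \<open>P\<close>. Since \<open>f \<boxplus> P' = f\<close>, the ultrafilter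
  \<open>P' \<boxplus> f\<close> is itself idempotent.\<close>

lemma first_entries_ultrafilter:
  fixes S :: "real set" and B :: "'j \<Rightarrow> nat \<Rightarrow> nat" and c :: "nat \<Rightarrow> nat" and lev :: "'j \<Rightarrow> nat"
  assumes S: "\<And>x y. x \<in> S \<Longrightarrow> y \<in> S \<Longrightarrow> x + y \<in> S"
    and P: "P \<in> left_minimal (near_zero_ultras S)" "P \<boxplus> P = P"
    and c: "\<And>k. k < m \<Longrightarrow> 0 < c k" "\<And>k. k < m \<Longrightarrow> (\<lambda>s. real (c k) * s) ` S \<in> P"
    and lev: "\<And>j. j \<in> J \<Longrightarrow> lev j < m" "\<And>j. j \<in> J \<Longrightarrow> B j (lev j) = c (lev j)"
      "\<And>j i. j \<in> J \<Longrightarrow> i < lev j \<Longrightarrow> B j i = 0"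
    and "k \<le> m"
  shows "\<exists>q\<in>ultras. q \<boxplus> q = q \<and>
      (\<forall>\<epsilon>>0. {y. \<forall>i<m. if i < k then y i = 0 else y i \<in> S \<inter> {0<..<\<epsilon>}} \<in> q) \<and>
      (\<forall>j\<in>J. k \<le> lev j \<longrightarrow> image_ultra (\<lambda>y. \<Sum>i<m. real (B j i) * y i) q = P)"
  using \<open>k \<le> m\<close>
proof (induction k rule: inc_induct)
  case base
  have "principal 0 \<boxplus> principal (0 :: nat \<Rightarrow> real) = principal 0" by (rule principal_zero_plus)
  moreover have "{y. \<forall>i<m. if i < m then y i = 0 else y i \<in> S \<inter> {0<..<\<epsilon>}} \<in> principal 0" for \<epsilon>
    by (simp add: principal_def)
  ultimately show ?case using lev(1) principal_ultra by (intro bexI[of _ "principal 0"]) force+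
next
  case (step k)
  \<comment> \<open>\<open>N k \<epsilon>\<close> consists of the small vectors supported on the coordinates from \<open>k\<close> on, and \<open>M \<epsilon>\<close>
    below of the small vectors supported on coordinate \<open>k\<close> alone.\<close>
  define N where "N k \<epsilon> = {y. \<forall>i<m. if i < k then y i = 0 else y i \<in> S \<inter> {0<..<\<epsilon>}}" for k and \<epsilon> :: real
  define \<phi> where "\<phi> j y = (\<Sum>i<m. real (B j i) * y i)" for j y
  have \<phi>_add: "\<phi> j (x + y) = \<phi> j x + \<phi> j y" for j x y
    by (simp add: \<phi>_def distrib_left sum.distrib)
  obtain q where q: "q \<in> ultras" "q \<boxplus> q = q" "\<And>\<epsilon>. \<epsilon> > 0 \<Longrightarrow> N (Suc k) \<epsilon> \<in> q"
    "\<And>j. j \<in> J \<Longrightarrow> Suc k \<le> lev j \<Longrightarrow> image_ultra (\<phi> j) q = P"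
    using step.IH unfolding N_def \<phi>_def by auto
  have km: "k < m" by (rule step.hyps)
  have PT: "P \<in> near_zero_ultras S" using P(1) by (simp add: left_minimal_def)
  have Pu: "P \<in> ultras" using PT by (simp add: near_zero_ultras_iff)
  have ck: "0 < c k" by (rule c(1)[OF km])
  define emb where "emb s = (\<lambda>i. if i = k then s / real (c k) else 0)" for s :: real
  define \<pi> where "\<pi> y = (\<lambda>i. if i = k then 0 else y i)" for y :: "nat \<Rightarrow> real"
  have emb_add: "emb (x + y) = emb x + emb y" for x y
    by (auto simp: emb_def add_divide_distrib)
  have \<pi>_add: "\<pi> (x + y) = \<pi> x + \<pi> y" for x y
    by (auto simp: \<pi>_def)
  define P' where "P' = image_ultra emb P"
  have P'u: "P' \<in> ultras" unfolding P'_def by (rule image_ultra_closed[OF Pu])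
  have P'P': "P' \<boxplus> P' = P'"
    unfolding P'_def using P(2) by (simp add: emb_add flip: image_ultra_plus)
  have \<pi>P': "image_ultra \<pi> P' = principal 0"
  proof -
    have "\<pi> \<circ> emb = (\<lambda>_. 0)" by (simp add: fun_eq_iff \<pi>_def emb_def)
    then show ?thesis unfolding P'_def image_ultra_comp by (simp add: image_ultra_const[OF Pu])
  qed
  have \<pi>q: "image_ultra \<pi> q = q"
  proof -
    have "image_ultra \<pi> q = image_ultra (\<lambda>y. y) q"
    proof (rule image_ultra_cong[OF q(1) q(3)[of 1]])
      fix y assume "y \<in> N (Suc k) 1"
      then show "\<pi> y = y" using km by (auto simp: N_def \<pi>_def)
    qed simp
    then show ?thesis by (simp add: image_ultra_id)
  qed
  define M where "M \<epsilon> = {y. \<forall>i. if i = k then y i \<in> S \<inter> {0<..<\<epsilon>} else y i = 0}" for \<epsilon> :: real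
  have P'M: "M \<epsilon> \<in> P'" if "\<epsilon> > 0" for \<epsilon>
  proof -
    have "(\<lambda>s. real (c k) * s) ` S \<inter> ({0<..<\<epsilon>} \<inter> S) \<in> P"
      using c(2)[OF km] PT that by (simp add: ultra_Int[OF Pu] near_zero_ultras_iff del: Int_iff)
    moreover have "emb s \<in> M \<epsilon>" if "s \<in> (\<lambda>s. real (c k) * s) ` S \<inter> ({0<..<\<epsilon>} \<inter> S)" for s
    proof -
      from that obtain u where u: "s = real (c k) * u" "u \<in> S" by blast
      have "0 < s" "s < \<epsilon>" using that by auto
      moreover have su: "s / real (c k) = u" using u(1) ck by simp
      moreover have "s / real (c k) \<le> s"
        using ck \<open>0 < s\<close> by (simp add: divide_le_eq)
      moreover have "0 < s / real (c k)" using ck \<open>0 < s\<close> by simp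
      ultimately have "u \<in> S \<inter> {0<..<\<epsilon>}" using u(2) by auto
      then show ?thesis unfolding M_def emb_def su by auto
    qed
    ultimately show ?thesis unfolding P'_def by (rule image_ultra_memI[OF Pu])
  qed
  define R where "R = {r\<in>ultras. N k ` {0<..} \<union> (\<lambda>A. \<pi> -` A) ` q \<subseteq> r}"
  have R_iff: "r \<in> R \<longleftrightarrow> r \<in> ultras \<and> (\<forall>\<epsilon>>0. N k \<epsilon> \<in> r) \<and> image_ultra \<pi> r = q" for r
  proof -
    have "image_ultra \<pi> r = q \<longleftrightarrow> (\<lambda>A. \<pi> -` A) ` q \<subseteq> r" if "r \<in> ultras"
    proof -
      have "image_ultra \<pi> r = q \<longleftrightarrow> q \<subseteq> image_ultra \<pi> r"
        using ultra_eqI[OF q(1) image_ultra_closed[OF that], of \<pi>] by auto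
      then show ?thesis by (auto simp: image_ultra_def)
    qed
    then show ?thesis by (auto simp: R_def)
  qed
  have R_closed: "closed_ultras R" unfolding R_def by (rule closed_ultras_containing)
  have add_N: "x + y \<in> N k \<epsilon>"
    if "x \<in> M (\<epsilon>/2) \<and> y \<in> N k (\<epsilon>/2) \<union> N (Suc k) (\<epsilon>/2) \<or> x \<in> N k (\<epsilon>/2) \<and> y \<in> N k (\<epsilon>/2) \<union> M (\<epsilon>/2)"
    for x y \<epsilon>
    unfolding N_def
  proof (intro CollectI allI impI)
    fix i assume i: "i < m"
    show "if i < k then (x + y) i = 0 else (x + y) i \<in> S \<inter> {0<..<\<epsilon>}"
    proof -
      let ?s = "S \<inter> {0<..<\<epsilon>/2}"
      have "(if i = k then x i \<in> ?s else x i = 0) \<and>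
            ((if i < k then y i = 0 else y i \<in> ?s) \<or> (if i < Suc k then y i = 0 else y i \<in> ?s)) \<or>
          (if i < k then x i = 0 else x i \<in> ?s) \<and>
            ((if i < k then y i = 0 else y i \<in> ?s) \<or> (if i = k then y i \<in> ?s else y i = 0))"
        using that i unfolding N_def M_def by blast
      then show ?thesis
        using S[of "x i" "y i"] by (cases i k rule: linorder_cases) auto
    qed
  qed
  have R_plus: "r \<boxplus> s \<in> R" if "r \<in> R \<and> s \<in> R \<union> {P'} \<or> r = P' \<and> s \<in> R \<union> {q}" for r s
  proof -
    have u: "r \<in> ultras" "s \<in> ultras" using that P'u q(1) by (auto simp: R_iff)
    have "N k \<epsilon> \<in> r \<boxplus> s" if "\<epsilon> > 0" for \<epsilon>
    proof -
      have e: "\<epsilon> / 2 > 0" using that by simp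
      from \<open>r \<in> R \<and> s \<in> R \<union> {P'} \<or> r = P' \<and> s \<in> R \<union> {q}\<close> show ?thesis
      proof (elim disjE conjE)
        assume "r \<in> R" "s \<in> R \<union> {P'}"
        then have "N k (\<epsilon>/2) \<in> r" "N k (\<epsilon>/2) \<in> s \<or> M (\<epsilon>/2) \<in> s"
          using e P'M[OF e] by (auto simp: R_iff)
        then have "N k (\<epsilon>/2) \<in> r" "N k (\<epsilon>/2) \<union> M (\<epsilon>/2) \<in> s" by (simp_all add: ultra_UnI[OF u(2)])
        then show ?thesis by (rule ultra_plus_superset[OF u]) (rule add_N, blast)
      next
        assume "r = P'" "s \<in> R \<union> {q}"
        then have "M (\<epsilon>/2) \<in> r" "N k (\<epsilon>/2) \<in> s \<or> N (Suc k) (\<epsilon>/2) \<in> s"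
          using e P'M[OF e] q(3)[OF e] by (auto simp: R_iff)
        then have "M (\<epsilon>/2) \<in> r" "N k (\<epsilon>/2) \<union> N (Suc k) (\<epsilon>/2) \<in> s"
          by (simp_all add: ultra_UnI[OF u(2)])
        then show ?thesis by (rule ultra_plus_superset[OF u]) (rule add_N, blast)
      qed
    qed
    moreover have "image_ultra \<pi> (r \<boxplus> s) = q"
      using that \<pi>P' \<pi>q q(2) by (auto simp: image_ultra_plus[of \<pi>, OF \<pi>_add] R_iff principal_zero_plus)
    ultimately show ?thesis using ultra_plus_closed[OF u] by (simp add: R_iff)
  qed
  let ?X = "(\<lambda>r. r \<boxplus> P') ` R"
  obtain f where f: "f \<in> ?X" "f \<boxplus> f = f"
  proof (rule idempotent_exists)
    show "closed_ultras ?X" by (rule closed_ultras_translate[OF R_closed P'u])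
    have "P' \<boxplus> q \<in> R" by (rule R_plus) simp
    then show "?X \<noteq> {}" by blast
    fix a b assume "a \<in> ?X" "b \<in> ?X"
    then obtain r s where rs: "r \<in> R" "s \<in> R" "a = r \<boxplus> P'" "b = s \<boxplus> P'" by blast
    have "r \<boxplus> (P' \<boxplus> s) \<in> R" using rs R_plus by simp
    moreover have "a \<boxplus> b = (r \<boxplus> (P' \<boxplus> s)) \<boxplus> P'" by (simp add: rs ultra_plus_assoc)
    ultimately show "a \<boxplus> b \<in> ?X" by blast
  qed
  then obtain r where r: "r \<in> R" "f = r \<boxplus> P'" by blast
  have fR: "f \<in> R" using r R_plus by simp
  have fP': "f \<boxplus> P' = f" by (simp add: r(2) ultra_plus_assoc P'P')
  define q' where "q' = P' \<boxplus> f"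
  have q'R: "q' \<in> R" unfolding q'_def using fR R_plus by simp
  have "q' \<boxplus> q' = P' \<boxplus> ((f \<boxplus> P') \<boxplus> f)" by (simp add: q'_def ultra_plus_assoc)
  then have "q' \<boxplus> q' = q'" by (simp add: fP' f(2) q'_def)
  moreover have "image_ultra (\<phi> j) q' = P" if j: "j \<in> J" "k \<le> lev j" for j
  proof (cases "lev j = k")
    case True
    have \<phi>P': "image_ultra (\<phi> j) P' = P"
    proof -
      have "(\<phi> j \<circ> emb) s = s" for s
        using km ck lev(2)[OF j(1)] True by (simp add: \<phi>_def emb_def if_distrib cong: if_cong)
      then show ?thesis unfolding P'_def image_ultra_comp by (rule image_ultra_id)
    qed
    have "image_ultra (\<phi> j) r \<in> near_zero_ultras S"
      unfolding near_zero_ultras_iff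
    proof (intro conjI allI impI)
      have ru: "r \<in> ultras" using r(1) by (simp add: R_iff)
      show "image_ultra (\<phi> j) r \<in> ultras" by (rule image_ultra_closed[OF ru])
      fix \<epsilon> :: real assume e: "\<epsilon> > 0"
      \<comment> \<open>The denominator \<open>b + 1\<close> makes the resulting bound \<open>b * (\<epsilon> / (b + 1))\<close> strictly smaller than \<open>\<epsilon>\<close>.\<close>
      define b where "b = (\<Sum>i<m. real (B j i))"
      have b: "b \<ge> 0" by (simp add: b_def sum_nonneg)
      have "N k (\<epsilon> / (b + 1)) \<in> r" using r(1) e b by (simp add: R_iff)
      moreover have "\<phi> j y \<in> {0<..<\<epsilon>} \<inter> S" if y: "y \<in> N k (\<epsilon> / (b + 1))" for y
      proof -
        have yi: "y i \<in> S" "0 < y i" "y i \<le> \<epsilon> / (b + 1)" if "i < m" "B j i \<noteq> 0" for i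
        proof -
          have "\<not> i < k" using lev(3)[OF j(1), of i] True that(2) by auto
          then have "y i \<in> S \<inter> {0<..<\<epsilon> / (b + 1)}" using y that(1) unfolding N_def by auto
          then show "y i \<in> S" "0 < y i" "y i \<le> \<epsilon> / (b + 1)" by auto
        qed
        have nz: "\<exists>i\<in>{..<m}. B j i \<noteq> 0"
          using km lev(2)[OF j(1)] True ck by (intro bexI[of _ k]) auto
        have "\<phi> j y \<in> S" unfolding \<phi>_def
          by (rule nat_combination_mem[OF S _ _ nz]) (simp_all add: yi(1))
        moreover have "\<phi> j y \<in> {0<..}" unfolding \<phi>_def
          by (rule nat_combination_mem[OF _ _ _ nz]) (simp_all add: yi(2))
        moreover have "\<phi> j y \<le> (\<Sum>i<m. real (B j i) * (\<epsilon> / (b + 1)))"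
          unfolding \<phi>_def
        proof (rule sum_mono)
          fix i assume "i \<in> {..<m}"
          then show "real (B j i) * y i \<le> real (B j i) * (\<epsilon> / (b + 1))"
          proof (cases "B j i = 0")
            case False
            then have "y i \<le> \<epsilon> / (b + 1)" using yi(3) \<open>i \<in> {..<m}\<close> by simp
            then show ?thesis by (rule mult_left_mono) simp
          qed simp
        qed
        moreover have "(\<Sum>i<m. real (B j i) * (\<epsilon> / (b + 1))) = b * (\<epsilon> / (b + 1))"
          unfolding b_def by (rule sum_distrib_right[symmetric])
        moreover have "b * (\<epsilon> / (b + 1)) < \<epsilon>" using e b by (simp add: field_simps)
        ultimately show ?thesis by auto
      qed
      ultimately show "{0<..<\<epsilon>} \<inter> S \<in> image_ultra (\<phi> j) r" by (rule image_ultra_memI[OF ru])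
    qed
    moreover have "image_ultra (\<phi> j) f = image_ultra (\<phi> j) r \<boxplus> P"
      using \<phi>P' by (simp add: r(2) image_ultra_plus[of "\<phi> j", OF \<phi>_add])
    moreover have "image_ultra (\<phi> j) f \<boxplus> image_ultra (\<phi> j) f = image_ultra (\<phi> j) f"
      using f(2) by (simp flip: image_ultra_plus[of "\<phi> j", OF \<phi>_add])
    ultimately have "P \<boxplus> image_ultra (\<phi> j) f = P" by (rule left_minimal_absorbs[OF P(1)])
    then show ?thesis
      using \<phi>P' by (simp add: q'_def image_ultra_plus[of "\<phi> j", OF \<phi>_add])
  next
    case False
    have "\<phi> j (\<pi> y) = \<phi> j y" for y
      using lev(3)[OF j(1), of k] j(2) False unfolding \<phi>_def \<pi>_def by (intro sum.cong) auto
    then have "\<phi> j \<circ> \<pi> = \<phi> j" by (simp add: fun_eq_iff)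
    then have "image_ultra (\<phi> j) q' = image_ultra (\<phi> j) (image_ultra \<pi> q')"
      by (simp add: image_ultra_comp)
    then show ?thesis using q'R q(4)[OF j(1)] j(2) False by (simp add: R_iff)
  qed
  ultimately show ?case
    using q'R unfolding R_iff N_def \<phi>_def by (intro bexI[of _ q']) auto
qed

text \<open>With all columns treated, the preimages of \<open>D\<close> under the finitely many rows are members of one
  ultrafilter of vectors with entries in \<open>S\<close>, so that they have a common element.\<close>

lemma first_entries_image:
  fixes S :: "real set" and B :: "'j \<Rightarrow> nat \<Rightarrow> nat" and c :: "nat \<Rightarrow> nat" and lev :: "'j \<Rightarrow> nat"
  assumes S: "\<And>x y. x \<in> S \<Longrightarrow> y \<in> S \<Longrightarrow> x + y \<in> S"
    and P: "P \<in> left_minimal (near_zero_ultras S)" "P \<boxplus> P = P"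
    and c: "\<And>k. k < m \<Longrightarrow> 0 < c k" "\<And>k. k < m \<Longrightarrow> (\<lambda>s. real (c k) * s) ` S \<in> P"
    and lev: "\<And>j. j \<in> J \<Longrightarrow> lev j < m" "\<And>j. j \<in> J \<Longrightarrow> B j (lev j) = c (lev j)"
      "\<And>j i. j \<in> J \<Longrightarrow> i < lev j \<Longrightarrow> B j i = 0"
    and "finite J" "D \<in> P"
  obtains y where "\<And>i. i < m \<Longrightarrow> y i \<in> S" "\<And>j. j \<in> J \<Longrightarrow> (\<Sum>i<m. real (B j i) * y i) \<in> D"
proof -
  have "\<exists>q\<in>ultras. q \<boxplus> q = q \<and>
      (\<forall>\<epsilon>>0. {y. \<forall>i<m. if i < 0 then y i = 0 else y i \<in> S \<inter> {0<..<\<epsilon>}} \<in> q) \<and>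
      (\<forall>j\<in>J. 0 \<le> lev j \<longrightarrow> image_ultra (\<lambda>y. \<Sum>i<m. real (B j i) * y i) q = P)"
    by (rule first_entries_ultrafilter[where S = S and c = c and lev = lev]) (simp_all add: S P c lev)
  then obtain q where q: "q \<in> ultras"
    "\<forall>\<epsilon>>0. {y. \<forall>i<m. if i < 0 then y i = 0 else y i \<in> S \<inter> {0<..<\<epsilon>}} \<in> q"
    "\<forall>j\<in>J. 0 \<le> lev j \<longrightarrow> image_ultra (\<lambda>y. \<Sum>i<m. real (B j i) * y i) q = P"
    by (elim bexE conjE)
  have qS: "{y. \<forall>i<m. y i \<in> S \<inter> {0<..<1}} \<in> q" using q(2)[rule_format, of 1] by simp
  have "(\<lambda>y. \<Sum>i<m. real (B j i) * y i) -` D \<in> q" if "j \<in> J" for j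
    using q(3) that \<open>D \<in> P\<close> by (auto simp: image_ultra_def)
  then have "(\<Inter>j\<in>J. (\<lambda>y. \<Sum>i<m. real (B j i) * y i) -` D) \<in> q"
    by (intro ultra_INT[OF q(1) \<open>finite J\<close>])
  then have "{y. \<forall>i<m. y i \<in> S \<inter> {0<..<1}} \<inter> (\<Inter>j\<in>J. (\<lambda>y. \<Sum>i<m. real (B j i) * y i) -` D) \<in> q"
    using qS by (simp add: ultra_Int[OF q(1)] del: Int_iff)
  then obtain y where "y \<in> {y. \<forall>i<m. y i \<in> S \<inter> {0<..<1}} \<inter> (\<Inter>j\<in>J. (\<lambda>y. \<Sum>i<m. real (B j i) * y i) -` D)"
    using ultra_nonempty[OF q(1)] by blast
  then show thesis using that[of y] by simp
qed

section \<open>Rational approximation of real solutions\<close>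

text \<open>This is the Fredholm alternative over a field. In the induction step, a functional that separates
  the new column \<open>d\<close> from the span of the old ones is used to remove the component along \<open>d\<close>, both from
  \<open>b\<close> and from a functional that separates the rest of \<open>b\<close>.\<close>

lemma span_or_separated:
  fixes a :: "'i \<Rightarrow> 'w \<Rightarrow> 'k::field"
  assumes "finite I" and W: "finite W"
  shows "(\<exists>x. \<forall>w\<in>W. b w = (\<Sum>i\<in>I. x i * a i w)) \<or>
    (\<exists>f. (\<forall>i\<in>I. (\<Sum>w\<in>W. f w * a i w) = 0) \<and> (\<Sum>w\<in>W. f w * b w) \<noteq> 0)"
  using \<open>finite I\<close>
proof (induction I arbitrary: b rule: finite_induct)
  case empty
  show ?case
  proof (cases "\<forall>w\<in>W. b w = 0")
    case False
    then obtain w where w: "w \<in> W" "b w \<noteq> 0" by blast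
    then have "(\<Sum>v\<in>W. (if v = w then 1 else 0) * b v) \<noteq> 0" using W by (simp add: if_distrib[of "\<lambda>x. x * _"] cong: if_cong)
    then show ?thesis by auto
  qed simp
next
  case (insert d I)
  note IH = insert.IH
  have upd: "(\<Sum>i\<in>insert d I. (x(d := t)) i * a i w) = t * a d w + (\<Sum>i\<in>I. x i * a i w)" for x t w
  proof -
    have "(\<Sum>i\<in>I. (x(d := t)) i * a i w) = (\<Sum>i\<in>I. x i * a i w)"
      using insert(2) by (intro sum.cong) auto
    then show ?thesis using insert(1,2) by simp
  qed
  from IH[of "a d"] show ?case
  proof (elim disjE exE conjE)
    fix x assume x: "\<forall>w\<in>W. a d w = (\<Sum>i\<in>I. x i * a i w)"
    from IH[of b] show ?thesis
    proof (elim disjE exE conjE)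
      fix z assume z: "\<forall>w\<in>W. b w = (\<Sum>i\<in>I. z i * a i w)"
      then have "\<forall>w\<in>W. b w = (\<Sum>i\<in>insert d I. (z(d := 0)) i * a i w)" unfolding upd by simp
      then show ?thesis by blast
    next
      fix f assume f: "\<forall>i\<in>I. (\<Sum>w\<in>W. f w * a i w) = 0" "(\<Sum>w\<in>W. f w * b w) \<noteq> 0"
      have "(\<Sum>w\<in>W. f w * a d w) = (\<Sum>w\<in>W. \<Sum>i\<in>I. x i * (f w * a i w))"
        using x by (intro sum.cong) (simp_all add: sum_distrib_left algebra_simps)
      also have "\<dots> = (\<Sum>i\<in>I. x i * (\<Sum>w\<in>W. f w * a i w))"
        by (subst sum.swap) (simp add: sum_distrib_left)
      also have "\<dots> = 0" using f(1) by simp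
      finally show ?thesis using f by blast
    qed
  next
    fix g assume g: "\<forall>i\<in>I. (\<Sum>w\<in>W. g w * a i w) = 0" "(\<Sum>w\<in>W. g w * a d w) \<noteq> 0"
    define t where "t = (\<Sum>w\<in>W. g w * b w) / (\<Sum>w\<in>W. g w * a d w)"
    from IH[of "\<lambda>w. b w - t * a d w"] show ?thesis
    proof (elim disjE exE conjE)
      fix z assume z: "\<forall>w\<in>W. b w - t * a d w = (\<Sum>i\<in>I. z i * a i w)"
      have "\<forall>w\<in>W. b w = (\<Sum>i\<in>insert d I. (z(d := t)) i * a i w)"
        unfolding upd using z by (auto simp: algebra_simps)
      then show ?thesis by blast
    next
      fix f assume f: "\<forall>i\<in>I. (\<Sum>w\<in>W. f w * a i w) = 0" "(\<Sum>w\<in>W. f w * (b w - t * a d w)) \<noteq> 0"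
      define u where "u = (\<Sum>w\<in>W. f w * a d w) / (\<Sum>w\<in>W. g w * a d w)"
      define h where "h w = f w - u * g w" for w
      have h: "(\<Sum>w\<in>W. h w * v w) = (\<Sum>w\<in>W. f w * v w) - u * (\<Sum>w\<in>W. g w * v w)" for v
        by (simp add: h_def left_diff_distrib sum_subtractf sum_distrib_left mult.assoc)
      have "(\<Sum>w\<in>W. f w * (b w - t * a d w)) = (\<Sum>w\<in>W. f w * b w) - t * (\<Sum>w\<in>W. f w * a d w)"
        by (simp add: right_diff_distrib sum_subtractf sum_distrib_left mult.left_commute)
      also have "\<dots> = (\<Sum>w\<in>W. h w * b w)" unfolding h by (simp add: t_def u_def)
      finally have "(\<Sum>w\<in>W. h w * b w) \<noteq> 0" using f(2) by simp
      moreover have "\<forall>i\<in>insert d I. (\<Sum>w\<in>W. h w * a i w) = 0"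
        unfolding h using f(1) g by (auto simp: u_def)
      ultimately show ?thesis by blast
    qed
  qed
qed

text \<open>The entries of \<open>t\<close> are approximated one after the other. For an entry that is a rational
  combination of the previous ones, the same combination of their approximations is a good one. Any
  other entry takes part in no rational relation with the previous ones and is approximated freely.\<close>

lemma rational_approximation:
  fixes t :: "'w \<Rightarrow> real"
  assumes "finite W" "0 < \<epsilon>"
  shows "\<exists>t' :: 'w \<Rightarrow> rat. (\<forall>w\<in>W. \<bar>of_rat (t' w) - t w\<bar> < \<epsilon>) \<and>
    (\<forall>f :: 'w \<Rightarrow> rat. (\<Sum>w\<in>W. of_rat (f w) * t w) = 0 \<longrightarrow> (\<Sum>w\<in>W. f w * t' w) = 0)"
  using assms
proof (induction W arbitrary: \<epsilon> rule: finite_induct)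
  case (insert a W)
  have upd: "(\<Sum>w\<in>W. f w * (t'(a := c)) w) = (\<Sum>w\<in>W. f w * t' w)" for f :: "'w \<Rightarrow> rat" and t' c
    using insert(2) by (intro sum.cong) auto
  show ?case
  proof (cases "\<exists>q :: 'w \<Rightarrow> rat. t a = (\<Sum>w\<in>W. of_rat (q w) * t w)")
    case True
    then obtain q :: "'w \<Rightarrow> rat" where q: "t a = (\<Sum>w\<in>W. of_rat (q w) * t w)" by blast
    define K where "K = 1 + (\<Sum>w\<in>W. \<bar>of_rat (q w) :: real\<bar>)"
    have K: "K \<ge> 1" by (simp add: K_def sum_nonneg)
    then have "\<epsilon> / K > 0" "\<epsilon> / K \<le> \<epsilon>" using insert.prems by (simp_all add: divide_le_eq)
    then obtain t' where t': "\<forall>w\<in>W. \<bar>of_rat (t' w) - t w\<bar> < \<epsilon> / K"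
      "\<And>f :: 'w \<Rightarrow> rat. (\<Sum>w\<in>W. of_rat (f w) * t w) = 0 \<Longrightarrow> (\<Sum>w\<in>W. f w * t' w) = 0"
      using insert.IH[of "\<epsilon> / K"] by blast
    define c where "c = (\<Sum>w\<in>W. q w * t' w)"
    have "\<bar>of_rat c - t a\<bar> = \<bar>\<Sum>w\<in>W. of_rat (q w) * (of_rat (t' w) - t w)\<bar>"
      unfolding q c_def by (simp add: of_rat_sum of_rat_mult right_diff_distrib sum_subtractf)
    also have "\<dots> \<le> (\<Sum>w\<in>W. \<bar>of_rat (q w)\<bar> * (\<epsilon> / K))"
    proof (rule order_trans[OF sum_abs sum_mono])
      fix w assume "w \<in> W"
      then have "\<bar>of_rat (t' w) - t w\<bar> \<le> \<epsilon> / K" using t'(1) by force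
      then show "\<bar>of_rat (q w) * (of_rat (t' w) - t w)\<bar> \<le> \<bar>of_rat (q w)\<bar> * (\<epsilon> / K)"
        unfolding abs_mult by (intro mult_left_mono) auto
    qed
    also have "\<dots> = (\<Sum>w\<in>W. \<bar>of_rat (q w)\<bar>) * (\<epsilon> / K)" by (rule sum_distrib_right[symmetric])
    also have "\<dots> = (K - 1) * (\<epsilon> / K)" by (simp add: K_def)
    also have "\<dots> < K * (\<epsilon> / K)" using \<open>\<epsilon> / K > 0\<close> by (intro mult_strict_right_mono) auto
    also have "\<dots> = \<epsilon>" using K by simp
    finally have "\<bar>of_rat c - t a\<bar> < \<epsilon>" .
    then have "\<forall>w\<in>insert a W. \<bar>of_rat ((t'(a := c)) w) - t w\<bar> < \<epsilon>"
      using t'(1) \<open>\<epsilon> / K \<le> \<epsilon>\<close> by fastforce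
    moreover have "(\<Sum>w\<in>insert a W. f w * (t'(a := c)) w) = 0"
      if f: "(\<Sum>w\<in>insert a W. of_rat (f w) * t w) = 0" for f :: "'w \<Rightarrow> rat"
    proof -
      have "(\<Sum>w\<in>W. of_rat (f a * q w + f w) * t w) = of_rat (f a) * t a + (\<Sum>w\<in>W. of_rat (f w) * t w)"
        unfolding q by (simp add: of_rat_add of_rat_mult distrib_right sum.distrib sum_distrib_left mult.assoc)
      then have "(\<Sum>w\<in>W. (f a * q w + f w) * t' w) = 0" using f insert(1,2) by (intro t'(2)) simp
      then show ?thesis
        using insert(1,2) by (simp add: upd c_def distrib_right sum.distrib sum_distrib_left mult.assoc del: fun_upd_apply)
          (simp add: c_def sum_distrib_left mult.assoc)
    qed
    ultimately show ?thesis by blast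
  next
    case False
    obtain t' where t': "\<forall>w\<in>W. \<bar>of_rat (t' w) - t w\<bar> < \<epsilon>"
      "\<And>f :: 'w \<Rightarrow> rat. (\<Sum>w\<in>W. of_rat (f w) * t w) = 0 \<Longrightarrow> (\<Sum>w\<in>W. f w * t' w) = 0"
      using insert.IH[OF insert.prems] by blast
    obtain c where c: "t a - \<epsilon> < of_rat c" "of_rat c < t a + \<epsilon>"
      using of_rat_dense[of "t a - \<epsilon>" "t a + \<epsilon>"] insert.prems by auto
    have "\<forall>w\<in>insert a W. \<bar>of_rat ((t'(a := c)) w) - t w\<bar> < \<epsilon>"
      using t'(1) c by (auto simp: abs_less_iff)
    moreover have "(\<Sum>w\<in>insert a W. f w * (t'(a := c)) w) = 0"
      if f: "(\<Sum>w\<in>insert a W. of_rat (f w) * t w) = 0" for f :: "'w \<Rightarrow> rat"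
    proof -
      have fa: "of_rat (f a) * t a = - (\<Sum>w\<in>W. of_rat (f w) * t w)" using f insert(1,2) by simp
      have "f a = 0"
      proof (rule ccontr)
        assume nz: "f a \<noteq> 0"
        have "(\<Sum>w\<in>W. of_rat (- f w / f a) * t w) = - (\<Sum>w\<in>W. of_rat (f w) * t w) / of_rat (f a)"
          by (simp add: of_rat_divide of_rat_minus sum_negf sum_divide_distrib)
        also have "\<dots> = t a" using fa nz by (simp add: field_simps)
        finally show False using False by metis
      qed
      then show ?thesis using t'(2)[of f] f insert(1,2) by (simp add: upd del: fun_upd_apply)
    qed
    ultimately show ?thesis by blast
  qed
qed simp

text \<open>The image of a rational linear map is cut out by rational linear functionals. These vanish at
  the limit \<open>t\<close> of values of the map by continuity, hence also at a rational vector close to \<open>t\<close> that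
  satisfies the rational linear relations of \<open>t\<close>. So this vector is the value at a rational point.\<close>

lemma rational_solution_near_limit:
  fixes a :: "'i \<Rightarrow> 'w \<Rightarrow> rat" and x :: "nat \<Rightarrow> 'i \<Rightarrow> real" and t :: "'w \<Rightarrow> real"
  assumes I: "finite I" and W: "finite W"
    and lim: "\<And>w. w \<in> W \<Longrightarrow> (\<lambda>n. \<Sum>i\<in>I. x n i * of_rat (a i w)) \<longlonglongrightarrow> t w"
    and "0 < \<epsilon>"
  shows "\<exists>g :: 'i \<Rightarrow> rat. (\<forall>w\<in>W. \<bar>of_rat (\<Sum>i\<in>I. g i * a i w) - t w\<bar> < \<epsilon>) \<and>
    (\<forall>f :: 'w \<Rightarrow> rat. (\<Sum>w\<in>W. of_rat (f w) * t w) = 0 \<longrightarrow> (\<Sum>w\<in>W. f w * (\<Sum>i\<in>I. g i * a i w)) = 0)"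
proof -
  obtain t' :: "'w \<Rightarrow> rat" where t': "\<forall>w\<in>W. \<bar>of_rat (t' w) - t w\<bar> < \<epsilon>"
    "\<And>f :: 'w \<Rightarrow> rat. (\<Sum>w\<in>W. of_rat (f w) * t w) = 0 \<Longrightarrow> (\<Sum>w\<in>W. f w * t' w) = 0"
    using rational_approximation[OF W \<open>0 < \<epsilon>\<close>] by blast
  have "(\<Sum>w\<in>W. f w * t' w) = 0" if f: "\<forall>i\<in>I. (\<Sum>w\<in>W. f w * a i w) = 0" for f
  proof -
    have "(\<lambda>n. \<Sum>w\<in>W. of_rat (f w) * (\<Sum>i\<in>I. x n i * of_rat (a i w))) \<longlonglongrightarrow> (\<Sum>w\<in>W. of_rat (f w) * t w)"
      by (intro tendsto_intros lim)
    moreover have "(\<Sum>w\<in>W. of_rat (f w) * (\<Sum>i\<in>I. x n i * of_rat (a i w))) = 0" for n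
    proof -
      have "(\<Sum>w\<in>W. of_rat (f w) * (\<Sum>i\<in>I. x n i * of_rat (a i w)))
          = (\<Sum>i\<in>I. x n i * of_rat (\<Sum>w\<in>W. f w * a i w))"
        unfolding sum_distrib_left of_rat_sum of_rat_mult
        by (subst sum.swap) (simp add: mult.left_commute)
      then show ?thesis using f by simp
    qed
    ultimately have "(\<Sum>w\<in>W. of_rat (f w) * t w) = 0" by (simp add: LIMSEQ_const_iff)
    then show ?thesis by (rule t'(2))
  qed
  then obtain g where "\<forall>w\<in>W. t' w = (\<Sum>i\<in>I. g i * a i w)"
    using span_or_separated[OF I W, of t' a] by blast
  then show ?thesis using t' by (intro exI[of _ g]) (simp cong: sum.cong)
qed

section \<open>Orders of magnitude\<close>

lemma common_convergent_subsequence: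
  fixes f :: "'p \<Rightarrow> nat \<Rightarrow> real"
  assumes "finite P" "\<And>p n. p \<in> P \<Longrightarrow> f p n \<in> {0..1}"
  shows "\<exists>r. strict_mono r \<and> (\<forall>p\<in>P. convergent (\<lambda>n. f p (r n)))"
  using assms
proof (induction P rule: finite_induct)
  case empty
  show ?case by (intro exI[of _ id]) (simp add: strict_mono_def)
next
  case (insert a P)
  then obtain r where r: "strict_mono r" "\<And>p. p \<in> P \<Longrightarrow> convergent (\<lambda>n. f p (r n))" by auto
  have "seq_compact {0..1::real}" by (simp add: compact_imp_seq_compact)
  then obtain l s where s: "strict_mono s" "((\<lambda>n. f a (r n)) \<circ> s) \<longlonglongrightarrow> l"
    using insert.prems by (elim seq_compactE[of _ "\<lambda>n. f a (r n)"]) auto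
  have "convergent (\<lambda>n. f p ((r \<circ> s) n))" if "p \<in> insert a P" for p
  proof (cases "p = a")
    case True
    then show ?thesis using s(2) by (auto simp: convergent_def comp_def)
  next
    case False
    then have "p \<in> P" using that by simp
    then obtain l where "(\<lambda>n. f p (r n)) \<longlonglongrightarrow> l" using r(2) by (auto simp: convergent_def)
    from LIMSEQ_subseq_LIMSEQ[OF this s(1)] show ?thesis by (auto simp: convergent_def comp_def)
  qed
  then show ?case using strict_mono_o[OF r(1) s(1)] by blast
qed

definition dominates :: "(nat \<Rightarrow> 'w \<Rightarrow> real) \<Rightarrow> 'w \<Rightarrow> 'w \<Rightarrow> bool" where
  "dominates z a b \<longleftrightarrow> (\<lambda>n. z n b / z n a) \<longlonglongrightarrow> 0"

text \<open>The fractions \<open>z\<^sub>a / (z\<^sub>a + z\<^sub>b)\<close> are bounded, hence have limits along a subsequence. A limit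
  other than \<open>1\<close> makes \<open>z\<^sub>a / z\<^sub>b\<close> converge, and the limit \<open>1\<close> makes \<open>z\<^sub>b / z\<^sub>a\<close> tend to \<open>0\<close>.\<close>

lemma comparable_subsequence:
  fixes z :: "nat \<Rightarrow> 'w \<Rightarrow> real"
  assumes "finite W" and pos: "\<And>n w. w \<in> W \<Longrightarrow> 0 < z n w"
  obtains r where "strict_mono r"
    "\<And>a b. a \<in> W \<Longrightarrow> b \<in> W \<Longrightarrow>
      dominates (\<lambda>n. z (r n)) a b \<or> convergent (\<lambda>n. z (r n) a / z (r n) b)"
proof -
  define f where "f = (\<lambda>(a, b) n. z n a / (z n a + z n b))"
  have "f p n \<in> {0..1}" if p: "p \<in> W \<times> W" for p n
  proof -
    obtain a b where ab: "p = (a, b)" "a \<in> W" "b \<in> W" using p by auto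
    then show ?thesis using pos[of a n] pos[of b n] by (simp add: f_def divide_le_eq)
  qed
  then obtain r where r: "strict_mono r" "\<And>p. p \<in> W \<times> W \<Longrightarrow> convergent (\<lambda>n. f p (r n))"
    using common_convergent_subsequence[of "W \<times> W" f] \<open>finite W\<close> by blast
  have "dominates (\<lambda>n. z (r n)) a b \<or> convergent (\<lambda>n. z (r n) a / z (r n) b)"
    if ab: "a \<in> W" "b \<in> W" for a b
  proof -
    obtain l where l: "(\<lambda>n. f (a, b) (r n)) \<longlonglongrightarrow> l" using r(2)[of "(a, b)"] ab by (auto simp: convergent_def)
    have nz: "z n a \<noteq> 0" "z n b \<noteq> 0" "z n a + z n b \<noteq> 0" for n
      using pos[OF ab(1), of n] pos[OF ab(2), of n] by auto
    have f: "f (a, b) n = z n a / (z n a + z n b)" "1 - f (a, b) n = z n b / (z n a + z n b)" for n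
      using nz(3)[of n] by (simp_all add: f_def field_simps)
    show ?thesis
    proof (cases "l = 1")
      case True
      have "(1 - f (a, b) (r n)) / f (a, b) (r n) = z (r n) b / z (r n) a" for n
        unfolding f(2) unfolding f(1) using nz(3)[of "r n"] by simp
      moreover have "(\<lambda>n. (1 - f (a, b) (r n)) / f (a, b) (r n)) \<longlonglongrightarrow> (1 - l) / l"
        using True by (intro tendsto_intros l) simp
      ultimately show ?thesis using True by (simp only: dominates_def) simp
    next
      case False
      have "f (a, b) (r n) / (1 - f (a, b) (r n)) = z (r n) a / z (r n) b" for n
        unfolding f(2) unfolding f(1) using nz(3)[of "r n"] by simp
      moreover have "(\<lambda>n. f (a, b) (r n) / (1 - f (a, b) (r n))) \<longlonglongrightarrow> l / (1 - l)"
        using False by (intro tendsto_intros l) simp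
      ultimately show ?thesis unfolding convergent_def by (simp only:) blast
    qed
  qed
  with r(1) show thesis by (rule that)
qed

text \<open>Orders of magnitude are numbered from the largest one on; not every number need occur.\<close>

definition level :: "(nat \<Rightarrow> 'w \<Rightarrow> real) \<Rightarrow> 'w set \<Rightarrow> 'w \<Rightarrow> nat" where
  "level z W a = card {c\<in>W. dominates z c a}"

lemma level_less_iff:
  fixes z :: "nat \<Rightarrow> 'w \<Rightarrow> real"
  assumes W: "finite W" and pos: "\<And>n w. w \<in> W \<Longrightarrow> 0 < z n w"
    and comp: "\<And>a b. a \<in> W \<Longrightarrow> b \<in> W \<Longrightarrow> dominates z a b \<or> convergent (\<lambda>n. z n a / z n b)"
    and ab: "a \<in> W" "b \<in> W"
  shows "level z W a < level z W b \<longleftrightarrow> dominates z a b"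
proof -
  have trans: "dominates z c b"
    if "dominates z c a" "convergent (\<lambda>n. z n b / z n a)" "a \<in> W" for a b c
  proof -
    from that(2) obtain l where "(\<lambda>n. z n b / z n a) \<longlonglongrightarrow> l" by (auto simp: convergent_def)
    then have "(\<lambda>n. (z n b / z n a) * (z n a / z n c)) \<longlonglongrightarrow> l * 0"
      using that(1) unfolding dominates_def by (intro tendsto_mult)
    moreover have "(z n b / z n a) * (z n a / z n c) = z n b / z n c" for n
      using pos[OF that(3), of n] by simp
    ultimately show ?thesis unfolding dominates_def by (simp only: mult_zero_right)
  qed
  have less: "level z W a < level z W b" if d: "dominates z a b" and ab: "a \<in> W" "b \<in> W" for a b
  proof -
    have "convergent (\<lambda>n. z n b / z n a)" using d unfolding dominates_def convergent_def by blast
    then have "{c\<in>W. dominates z c a} \<subseteq> {c\<in>W. dominates z c b}" using trans ab(1) by auto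
    moreover have "z n a / z n a = 1" for n using pos[OF ab(1), of n] by simp
    then have "\<not> dominates z a a" by (simp add: dominates_def LIMSEQ_const_iff)
    ultimately have "{c\<in>W. dominates z c a} \<subset> {c\<in>W. dominates z c b}" using d ab(1) by blast
    then show ?thesis unfolding level_def using W by (intro psubset_card_mono) auto
  qed
  have le: "level z W a \<le> level z W b" if "\<not> dominates z b a" and ab: "a \<in> W" "b \<in> W" for a b
  proof -
    have "convergent (\<lambda>n. z n b / z n a)" using comp[OF ab(2,1)] that(1) by blast
    then have "{c\<in>W. dominates z c a} \<subseteq> {c\<in>W. dominates z c b}" using trans ab(1) by auto
    then show ?thesis unfolding level_def using W by (intro card_mono) auto
  qed
  show ?thesis using less[OF _ ab] le[OF _ ab(2,1)] by (meson leD)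
qed

text \<open>Divide the values \<open>z\<close> by an entry \<open>v\<close> of level \<open>k\<close> and forget the entries of larger order.
  Along a subsequence the remaining entries converge, to \<open>0\<close> for those of smaller order and to
  positive numbers for those of level \<open>k\<close>. A rational point \<open>g k\<close> with values close to this limit, and
  subject to its rational relations, inherits these zeros and signs. Two entries of level \<open>k\<close> in \<open>Y\<close>
  have equal limits, because the logarithm of their ratio is either close to \<open>0\<close> or large, and it
  stays bounded.\<close>

lemma leading_terms:
  fixes a :: "'i \<Rightarrow> 'w \<Rightarrow> rat" and x :: "nat \<Rightarrow> 'i \<Rightarrow> real" and I :: "'i set"
  defines "z \<equiv> \<lambda>n w. \<Sum>i\<in>I. x n i * of_rat (a i w)"
  assumes fin: "finite I" "finite W" and pos: "\<And>n w. w \<in> W \<Longrightarrow> 0 < z n w"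
    and "Y \<subseteq> W"
    and Y: "\<And>n w w'. w \<in> Y \<Longrightarrow> w' \<in> Y \<Longrightarrow>
      \<bar>ln (z n w / z n w')\<bar> < 1 / real (Suc n) \<or> real n \<le> \<bar>ln (z n w / z n w')\<bar>"
  obtains lev :: "'w \<Rightarrow> nat" and g :: "nat \<Rightarrow> 'i \<Rightarrow> rat" where
    "\<And>w. w \<in> W \<Longrightarrow> lev w \<le> card W"
    "\<And>w k. w \<in> W \<Longrightarrow> k < lev w \<Longrightarrow> (\<Sum>i\<in>I. g k i * a i w) = 0"
    "\<And>w. w \<in> W \<Longrightarrow> 0 < (\<Sum>i\<in>I. g (lev w) i * a i w)"
    "\<And>w w'. w \<in> Y \<Longrightarrow> w' \<in> Y \<Longrightarrow> lev w = lev w' \<Longrightarrow>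
      (\<Sum>i\<in>I. g (lev w) i * a i w) = (\<Sum>i\<in>I. g (lev w) i * a i w')"
proof -
  obtain r where r: "strict_mono r" and comp: "\<And>a b. a \<in> W \<Longrightarrow> b \<in> W \<Longrightarrow>
      dominates (\<lambda>n. z (r n)) a b \<or> convergent (\<lambda>n. z (r n) a / z (r n) b)"
    using comparable_subsequence[of W z] fin(2) pos by blast
  define y where "y = (\<lambda>n. z (r n))"
  have ypos: "0 < y n w" if "w \<in> W" for n w using pos[OF that] by (simp add: y_def)
  have ycomp: "dominates y a b \<or> convergent (\<lambda>n. y n a / y n b)" if "a \<in> W" "b \<in> W" for a b
    using comp[OF that] by (simp add: y_def)
  define lev where "lev = level y W"
  have lev: "lev a < lev b \<longleftrightarrow> dominates y a b" if "a \<in> W" "b \<in> W" for a b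
    unfolding lev_def by (rule level_less_iff[OF fin(2) ypos ycomp that])
  have yY: "(\<lambda>n. y n w / y n w') \<longlonglongrightarrow> 1"
    if w: "w \<in> Y" "w' \<in> Y" and l: "(\<lambda>n. y n w / y n w') \<longlonglongrightarrow> l" "l > 0" for w w' l
  proof -
    define d where "d n = \<bar>ln (y n w / y n w')\<bar>" for n
    have d: "d \<longlonglongrightarrow> \<bar>ln l\<bar>" unfolding d_def using l(2) by (intro tendsto_intros l(1)) simp
    then have "eventually (\<lambda>n. d n < \<bar>ln l\<bar> + 1) sequentially" by (rule order_tendstoD) simp
    moreover have "eventually (\<lambda>n. \<bar>ln l\<bar> + 1 \<le> real n) sequentially"
      using filterlim_real_sequentially unfolding filterlim_at_top by blast
    ultimately have "eventually (\<lambda>n. d n \<le> 1 / real (Suc n)) sequentially"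
    proof eventually_elim
      case (elim n)
      have rn: "n \<le> r n" using seq_suble[OF r] .
      then have "\<not> real (r n) \<le> d n" using elim by linarith
      then have "d n < 1 / real (Suc (r n))" using Y[OF w, of "r n"] by (auto simp: d_def y_def)
      also have "\<dots> \<le> 1 / real (Suc n)" using rn by (intro divide_left_mono) auto
      finally show ?case by simp
    qed
    moreover have "(\<lambda>n. 1 / real (Suc n)) \<longlonglongrightarrow> 0" by (rule LIMSEQ_Suc[OF lim_1_over_n])
    ultimately have "d \<longlonglongrightarrow> 0"
      by (intro tendsto_sandwich[of "\<lambda>_. 0" d sequentially "\<lambda>n. 1 / real (Suc n)"]) (auto simp: d_def)
    then have "\<bar>ln l\<bar> = 0" using d LIMSEQ_unique by blast
    then have "l = 1" using l(2) by simp
    then show ?thesis using l(1) by simp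
  qed
  define Q where "Q k g \<longleftrightarrow> (\<forall>w\<in>W. (k < lev w \<longrightarrow> (\<Sum>i\<in>I. g i * a i w) = 0) \<and>
      (lev w = k \<longrightarrow> 0 < (\<Sum>i\<in>I. g i * a i w)) \<and>
      (\<forall>w'\<in>Y. w \<in> Y \<longrightarrow> lev w = k \<longrightarrow> lev w' = k \<longrightarrow>
        (\<Sum>i\<in>I. g i * a i w) = (\<Sum>i\<in>I. g i * a i w')))" for k and g :: "'i \<Rightarrow> rat"
  have "\<exists>g. Q k g" for k
  proof (cases "\<exists>w\<in>W. lev w = k")
    case True
    then obtain v where v: "v \<in> W" "lev v = k" by blast
    define V where "V = {w\<in>W. k \<le> lev w}"
    have V: "finite V" "V \<subseteq> W" using fin(2) by (auto simp: V_def)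
    have "\<exists>l. (\<lambda>n. y n w / y n v) \<longlonglongrightarrow> l" if "w \<in> V" for w
      using ycomp[of w v] lev[of w v] v that by (auto simp: V_def convergent_def)
    then obtain t where t: "\<And>w. w \<in> V \<Longrightarrow> (\<lambda>n. y n w / y n v) \<longlonglongrightarrow> t w" by metis
    have t0: "0 \<le> t w" if "w \<in> V" for w
    proof (rule LIMSEQ_le_const[OF t[OF that]])
      have "0 \<le> y n w / y n v" for n
        using ypos[of w n] ypos[OF v(1), of n] V(2) that by (auto intro: divide_nonneg_nonneg less_imp_le)
      then show "\<exists>N. \<forall>n\<ge>N. 0 \<le> y n w / y n v" by blast
    qed
    have tz: "t w = 0 \<longleftrightarrow> k < lev w" if "w \<in> V" for w
    proof
      assume "t w = 0"
      then have "dominates y v w" using t[OF that] by (simp add: dominates_def)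
      then show "k < lev w" using lev[of v w] v V(2) that by auto
    next
      assume "k < lev w"
      then have "dominates y v w" using lev[of v w] v V(2) that by auto
      then show "t w = 0" using LIMSEQ_unique[OF t[OF that]] by (simp add: dominates_def)
    qed
    define \<epsilon> where "\<epsilon> = Min (insert 1 (t ` {w\<in>V. t w \<noteq> 0}))"
    have fM: "finite (insert 1 (t ` {w\<in>V. t w \<noteq> 0}))" using V(1) by simp
    have "0 < \<epsilon>" unfolding \<epsilon>_def using fM t0 by (subst Min_gr_iff) (auto simp: order_less_le)
    have \<epsilon>_le: "\<epsilon> \<le> t w" if "w \<in> V" "t w \<noteq> 0" for w
      unfolding \<epsilon>_def using fM that by (intro Min_le) auto
    have "(\<lambda>n. \<Sum>i\<in>I. (x (r n) i / y n v) * of_rat (a i w)) \<longlonglongrightarrow> t w" if "w \<in> V" for w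
      using t[OF that] by (simp add: y_def z_def sum_divide_distrib)
    then obtain g :: "'i \<Rightarrow> rat" where g: "\<forall>w\<in>V. \<bar>of_rat (\<Sum>i\<in>I. g i * a i w) - t w\<bar> < \<epsilon>"
      "\<And>f :: 'w \<Rightarrow> rat. (\<Sum>w\<in>V. of_rat (f w) * t w) = 0 \<Longrightarrow>
        (\<Sum>w\<in>V. f w * (\<Sum>i\<in>I. g i * a i w)) = 0"
      using rational_solution_near_limit[OF fin(1) V(1), of "\<lambda>n i. x (r n) i / y n v" a t \<epsilon>] \<open>0 < \<epsilon>\<close>
      by blast
    define u where "u w = (\<Sum>i\<in>I. g i * a i w)" for w
    \<comment> \<open>The relations that are needed say that an entry of the limit is zero (\<open>c = 1\<close>, \<open>d = 0\<close>) or
      that two entries are equal (\<open>c = d = 1\<close>).\<close>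
    have rel: "c * u w = d * u w'" if w: "w \<in> V" "w' \<in> V" and e: "of_rat c * t w = of_rat d * t w'" for w w' c d
    proof -
      have ind: "(\<Sum>s\<in>V. (if s = w then c else 0) * h s) = c * h w"
        "(\<Sum>s\<in>V. (if s = w' then d else 0) * h s) = d * h w'" for h :: "'w \<Rightarrow> rat"
        using V(1) w by (simp_all add: if_distrib[of "\<lambda>x. x * _"] cong: if_cong)
      have ind': "(\<Sum>s\<in>V. of_rat (if s = w then c else 0) * h s) = of_rat c * h w"
        "(\<Sum>s\<in>V. of_rat (if s = w' then d else 0) * h s) = of_rat d * h w'" for h :: "'w \<Rightarrow> real"
        using V(1) w by (simp_all add: if_distrib[of "\<lambda>x. of_rat x * _"] cong: if_cong)
      have "(\<Sum>s\<in>V. ((if s = w then c else 0) - (if s = w' then d else 0)) * u s) = 0"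
        unfolding u_def
      proof (rule g(2))
        show "(\<Sum>s\<in>V. of_rat ((if s = w then c else 0) - (if s = w' then d else 0)) * t s) = 0"
          unfolding of_rat_diff left_diff_distrib sum_subtractf ind' using e by simp
      qed
      then show ?thesis unfolding left_diff_distrib sum_subtractf ind by simp
    qed
    have low: "u w = 0" if w: "w \<in> W" "k < lev w" for w
    proof -
      have wV: "w \<in> V" using w by (simp add: V_def)
      then show ?thesis using rel[OF wV wV, of 1 0] tz[OF wV] w(2) by simp
    qed
    have pos: "0 < u w" if w: "w \<in> W" "lev w = k" for w
    proof -
      have wV: "w \<in> V" using w by (simp add: V_def)
      then have "\<epsilon> \<le> t w" using tz[OF wV] w(2) by (intro \<epsilon>_le) auto
      moreover have "\<bar>of_rat (u w) - t w\<bar> < \<epsilon>" using g(1) wV by (simp add: u_def)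
      ultimately have "(0::real) < of_rat (u w)" by linarith
      then show ?thesis by simp
    qed
    have same: "u w = u w'" if w: "w \<in> Y" "w' \<in> Y" "lev w = k" "lev w' = k" for w w'
    proof -
      have wV: "w \<in> V" "w' \<in> V" using w \<open>Y \<subseteq> W\<close> by (auto simp: V_def)
      have tpos: "0 < t w" "0 < t w'" using tz wV t0 w(3,4) by (auto simp: order_less_le)
      have "(\<lambda>n. (y n w / y n v) / (y n w' / y n v)) \<longlonglongrightarrow> t w / t w'"
        using tpos by (intro tendsto_intros t wV) simp
      moreover have "(y n w / y n v) / (y n w' / y n v) = y n w / y n w'" for n
        using ypos[OF v(1), of n] by simp
      ultimately have lim: "(\<lambda>n. y n w / y n w') \<longlonglongrightarrow> t w / t w'" by (simp only:)
      then have "t w / t w' = 1" using LIMSEQ_unique[OF lim yY[OF w(1,2) lim]] tpos by simp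
      then have "t w = t w'" using tpos by simp
      then show ?thesis using rel[OF wV, of 1 1] by simp
    qed
    show ?thesis unfolding Q_def
      by (intro exI[of _ g] ballI conjI impI; fold u_def) (simp add: low, simp add: pos, rule same)
  next
    case False
    then show ?thesis unfolding Q_def by (intro exI[of _ "\<lambda>_. 0"]) auto
  qed
  then obtain g where g: "\<And>k. Q k (g k)" by metis
  show thesis
  proof (rule that[of lev g])
    show "lev w \<le> card W" for w
      unfolding lev_def level_def using fin(2) by (intro card_mono) auto
    show "(\<Sum>i\<in>I. g k i * a i w) = 0" if "w \<in> W" "k < lev w" for w k
      using g[of k] that unfolding Q_def by blast
    show "0 < (\<Sum>i\<in>I. g (lev w) i * a i w)" if "w \<in> W" for w
      using g[of "lev w"] that unfolding Q_def by blast
    show "(\<Sum>i\<in>I. g (lev w) i * a i w) = (\<Sum>i\<in>I. g (lev w) i * a i w')"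
      if "w \<in> Y" "w' \<in> Y" "lev w = lev w'" for w w'
      using g[of "lev w"] that \<open>Y \<subseteq> W\<close> unfolding Q_def by (metis subsetD)
  qed
qed

section \<open>Image partition regular matrices and first entries\<close>

lemma common_denominator:
  fixes Q :: "rat set"
  assumes "finite Q"
  shows "\<exists>D :: nat. 0 < D \<and> (\<forall>q\<in>Q. of_nat D * q \<in> \<int>)"
  using assms
proof (induction Q rule: finite_induct)
  case empty
  show ?case by (intro exI[of _ 1]) simp
next
  case (insert q Q)
  then obtain D :: nat where D: "0 < D" "\<forall>q\<in>Q. of_nat D * q \<in> \<int>" by blast
  obtain a b where ab: "quotient_of q = (a, b)" by fastforce
  have b: "b > 0" using quotient_of_denom_pos[OF ab] .
  have q: "q = of_int a / of_int b" using quotient_of_div[OF ab] .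
  have nb: "of_nat (nat b) = (of_int b :: rat)" using b by simp
  have "of_nat (D * nat b) * q = of_int (int D * a)" using b by (simp add: q nb)
  then have "of_nat (D * nat b) * q \<in> \<int>" by (metis Ints_of_int)
  moreover have "of_nat (D * nat b) * r \<in> \<int>" if "r \<in> Q" for r :: rat
  proof -
    have "of_nat (D * nat b) * r = of_int b * (of_nat D * r)" by (simp add: nb)
    then show ?thesis using D(2) that by (metis Ints_mult Ints_of_int)
  qed
  ultimately show ?case using D(1) b by (intro exI[of _ "D * nat b"]) auto
qed

text \<open>The vector \<open>g k\<close> may have negative values only at entries of larger order than those of level
  \<open>k\<close>. There a large multiple of a combination of \<open>g 0, \<dots>, g (k - 1)\<close> compensates for them,
  and at the entries of level at least \<open>k\<close> this combination vanishes.\<close>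

lemma nonnegative_leading_terms:
  fixes a :: "'i \<Rightarrow> 'w \<Rightarrow> rat" and g :: "nat \<Rightarrow> 'i \<Rightarrow> rat" and lev :: "'w \<Rightarrow> nat"
  assumes W: "finite W"
    and g: "\<And>w k. w \<in> W \<Longrightarrow> k < lev w \<Longrightarrow> (\<Sum>i\<in>I. g k i * a i w) = 0"
      "\<And>w. w \<in> W \<Longrightarrow> 0 < (\<Sum>i\<in>I. g (lev w) i * a i w)"
  obtains h :: "nat \<Rightarrow> 'i \<Rightarrow> rat" where
    "\<And>w k. w \<in> W \<Longrightarrow> 0 \<le> (\<Sum>i\<in>I. h k i * a i w)"
    "\<And>w k. w \<in> W \<Longrightarrow> k < lev w \<Longrightarrow> (\<Sum>i\<in>I. h k i * a i w) = 0"
    "\<And>w. w \<in> W \<Longrightarrow> (\<Sum>i\<in>I. h (lev w) i * a i w) = (\<Sum>i\<in>I. g (lev w) i * a i w)"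
proof -
  define L where "L f w = (\<Sum>i\<in>I. f i * a i w)" for f :: "'i \<Rightarrow> rat" and w
  define Q where "Q k f \<longleftrightarrow> (\<forall>w\<in>W. (lev w < k \<longrightarrow> 0 < L f w) \<and> (k \<le> lev w \<longrightarrow> L f w = 0))"
    for k and f :: "'i \<Rightarrow> rat"
  have step: "\<exists>f'. Q (Suc k) f' \<and> (\<forall>w\<in>W. lev w = k \<longrightarrow> L f' w = L (g k) w)" if f: "Q k f" for k f
  proof -
    define N where "N = (\<Sum>w\<in>{w\<in>W. lev w < k}. \<bar>L (g k) w\<bar> / L f w) + 1"
    define f' where "f' i = g k i + N * f i" for i
    have f': "L f' w = L (g k) w + N * L f w" for w
      by (simp add: L_def f'_def distrib_right sum.distrib sum_distrib_left mult.assoc)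
    have "0 < L f' w" if w: "w \<in> W" "lev w < k" for w
    proof -
      have pos: "0 < L f w" using f w by (simp add: Q_def)
      have "\<bar>L (g k) w\<bar> / L f w \<le> (\<Sum>w\<in>{w\<in>W. lev w < k}. \<bar>L (g k) w\<bar> / L f w)"
        using w W f by (intro member_le_sum) (auto simp: Q_def intro: divide_nonneg_pos)
      then have "\<bar>L (g k) w\<bar> / L f w < N" by (simp add: N_def)
      then have "\<bar>L (g k) w\<bar> < N * L f w" using pos by (simp add: divide_less_eq)
      then show ?thesis unfolding f' by linarith
    qed
    moreover have "L f' w = L (g k) w" if "w \<in> W" "k \<le> lev w" for w
      using f that by (simp add: f' Q_def)
    moreover have "0 < L (g k) w" if "w \<in> W" "lev w = k" for w
      using g(2)[OF that(1)] that(2) by (simp add: L_def)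
    moreover have "L (g k) w = 0" if "w \<in> W" "k < lev w" for w
      using g(1)[OF that] by (simp add: L_def)
    ultimately have "Q (Suc k) f' \<and> (\<forall>w\<in>W. lev w = k \<longrightarrow> L f' w = L (g k) w)"
      unfolding Q_def by (auto simp: less_Suc_eq)
    then show ?thesis by blast
  qed
  have "\<exists>f. Q k f" for k
  proof (induction k)
    case 0
    show ?case by (intro exI[of _ "\<lambda>_. 0"]) (simp add: Q_def L_def)
  next
    case (Suc k)
    then show ?case using step by blast
  qed
  then have "\<exists>f'. Q (Suc k) f' \<and> (\<forall>w\<in>W. lev w = k \<longrightarrow> L f' w = L (g k) w)" for k
    using step by blast
  then obtain h where h: "\<And>k. Q (Suc k) (h k) \<and> (\<forall>w\<in>W. lev w = k \<longrightarrow> L (h k) w = L (g k) w)"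
    by metis
  show thesis
  proof (rule that[of h])
    fix w k assume w: "w \<in> W"
    have "lev w < Suc k \<or> Suc k \<le> lev w" by auto
    then show "0 \<le> (\<Sum>i\<in>I. h k i * a i w)" using h[of k] w by (auto simp: Q_def L_def less_imp_le)
    show "(\<Sum>i\<in>I. h k i * a i w) = 0" if "k < lev w" using h[of k] w that by (simp add: Q_def L_def)
    show "(\<Sum>i\<in>I. h (lev w) i * a i w) = (\<Sum>i\<in>I. g (lev w) i * a i w)"
      using h[of "lev w"] w by (simp add: L_def)
  qed
qed

text \<open>Color \<open>m\<close> by the residue of the integer part of \<open>k ln m\<close> modulo \<open>k\<^sup>2\<close>. For two numbers of
  the same color, these integer parts agree or differ by at least \<open>k\<^sup>2\<close>. So the ratio of the two
  numbers is close to \<open>1\<close>, or one of them is much larger than the other.\<close>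

lemma log_coloring:
  fixes k :: nat
  assumes "0 < k"
  shows "\<exists>\<chi> :: nat \<Rightarrow> nat. finite (range \<chi>) \<and> (\<forall>p q. 0 < p \<longrightarrow> 0 < q \<longrightarrow> \<chi> p = \<chi> q \<longrightarrow>
      \<bar>ln (real p / real q)\<bar> < 1 / real k \<or> real (k - 1) \<le> \<bar>ln (real p / real q)\<bar>)"
proof -
  define \<chi> where "\<chi> m = nat (\<lfloor>real k * ln (real m)\<rfloor> mod (int k)\<^sup>2)" for m
  have pos: "0 < (int k)\<^sup>2" using assms by simp
  have "\<chi> m < nat ((int k)\<^sup>2)" for m
    unfolding \<chi>_def using pos by (simp add: nat_less_eq_zless)
  then have "range \<chi> \<subseteq> {..<nat ((int k)\<^sup>2)}" by auto
  then have "finite (range \<chi>)" by (rule finite_subset) simp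
  moreover have "\<bar>ln (real p / real q)\<bar> < 1 / real k \<or> real (k - 1) \<le> \<bar>ln (real p / real q)\<bar>"
    if pq: "0 < p" "0 < q" "\<chi> p = \<chi> q" for p q :: nat
  proof -
    define s t where "s = real k * ln (real p)" and "t = real k * ln (real q)"
    have ln: "ln (real p / real q) = (s - t) / real k"
      using pq(1,2) assms by (simp add: s_def t_def ln_div field_simps)
    have "\<lfloor>s\<rfloor> mod (int k)\<^sup>2 = \<lfloor>t\<rfloor> mod (int k)\<^sup>2"
      using pq(3) pos by (simp add: \<chi>_def s_def t_def eq_nat_nat_iff)
    then have dvd: "(int k)\<^sup>2 dvd \<lfloor>s\<rfloor> - \<lfloor>t\<rfloor>" by (simp add: mod_eq_dvd_iff)
    show ?thesis
    proof (cases "\<lfloor>s\<rfloor> = \<lfloor>t\<rfloor>")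
      case True
      then have "\<bar>s - t\<bar> < 1" by linarith
      then show ?thesis unfolding ln using assms by (simp add: abs_divide divide_strict_right_mono)
    next
      case False
      then have "(int k)\<^sup>2 \<le> \<bar>\<lfloor>s\<rfloor> - \<lfloor>t\<rfloor>\<bar>" using dvd_imp_le_int[OF _ dvd] by simp
      then have "real_of_int ((int k)\<^sup>2) \<le> real_of_int \<bar>\<lfloor>s\<rfloor> - \<lfloor>t\<rfloor>\<bar>" by (rule of_int_le_iff[THEN iffD2])
      then have "real k * real k \<le> \<bar>s - t\<bar> + 1" unfolding power2_eq_square by simp linarith
      moreover have "real (k - 1) * real k \<le> real k * real k - 1"
        using assms by (simp add: of_nat_diff algebra_simps)
      ultimately have "real (k - 1) * real k \<le> \<bar>s - t\<bar>" by linarith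
      then show ?thesis unfolding ln using assms by (simp add: abs_divide pos_le_divide_eq)
    qed
  qed
  ultimately show ?thesis by (intro exI[of _ \<chi>] conjI allI impI)
qed

lemma image_partition_regular_solution:
  assumes A: "image_partition_regular A" and \<chi>: "finite (range \<chi>)"
  obtains x y :: "nat \<Rightarrow> nat" where
    "\<And>i. i < dim_col A \<Longrightarrow> 0 < x i" "\<And>j. j < dim_row A \<Longrightarrow> 0 < y j"
    "\<And>j j'. j < dim_row A \<Longrightarrow> j' < dim_row A \<Longrightarrow> \<chi> (y j) = (\<chi> (y j') :: nat)"
    "\<And>j. j < dim_row A \<Longrightarrow> (\<Sum>i<dim_col A. A $$ (j, i) * of_nat (x i)) = of_nat (y j)"
proof -
  have "finite (\<chi> ` {0<..})" using \<chi> by (rule finite_subset[rotated]) auto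
  then obtain x c where x: "dim_vec x = dim_col A" "\<forall>i < dim_col A. 0 < x $ i"
    "\<forall>j < dim_row A. \<exists>m :: nat. 0 < m \<and> \<chi> m = c \<and> (A *\<^sub>v map_vec of_nat x) $ j = of_nat m"
    using A unfolding image_partition_regular_def by blast
  from x(3) obtain y where y: "\<forall>j < dim_row A. 0 < y j \<and> \<chi> (y j) = c \<and>
      (A *\<^sub>v map_vec of_nat x) $ j = of_nat (y j)"
    by metis
  have "(A *\<^sub>v map_vec of_nat x) $ j = (\<Sum>i<dim_col A. A $$ (j, i) * of_nat (x $ i))"
    if "j < dim_row A" for j
    using that x(1) by (simp add: scalar_prod_def lessThan_atLeast0)
  then show thesis using that[of "\<lambda>i. x $ i" y] x(2) y by simp
qed

text \<open>Take images of \<open>A\<close> that are monochromatic for finer and finer logarithmic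
  colorings, and consider the orders of magnitude of the variables and of the values together. Column
  \<open>k\<close> of \<open>G\<close> is the rational point that reproduces the leading terms of level \<open>k\<close>, made nonnegative
  and integral. No row of \<open>G\<close> is zero, since the variable \<open>i\<close> is positive at its own level. A row of
  \<open>B = A G\<close> vanishes in the columns before its level, and rows of the same level have
  the same first entry because their values have the same color.\<close>

lemma image_partition_regular_first_entries:
  assumes A: "image_partition_regular A"
  obtains m :: nat and G B :: "nat \<Rightarrow> nat \<Rightarrow> nat" and lev c :: "nat \<Rightarrow> nat" where
    "\<And>i. i < dim_col A \<Longrightarrow> \<exists>k<m. G i k \<noteq> 0"
    "\<And>k. 0 < c k"
    "\<And>j. j < dim_row A \<Longrightarrow> lev j < m"
    "\<And>j. j < dim_row A \<Longrightarrow> B j (lev j) = c (lev j)"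
    "\<And>j k. j < dim_row A \<Longrightarrow> k < lev j \<Longrightarrow> B j k = 0"
    "\<And>j k. j < dim_row A \<Longrightarrow> k < m \<Longrightarrow>
      (\<Sum>i<dim_col A. A $$ (j, i) * of_nat (G i k)) = of_nat (B j k)"
proof -
  let ?I = "{..<dim_col A}" and ?J = "{..<dim_row A}"
  \<comment> \<open>The index \<open>Inl i\<close> stands for the variable \<open>i\<close>, and \<open>Inr j\<close> for the value of row \<open>j\<close>.\<close>
  define W :: "(nat + nat) set" where "W = Inl ` ?I \<union> Inr ` ?J"
  define a :: "nat \<Rightarrow> nat + nat \<Rightarrow> rat" where
    "a i w = (case w of Inl i' \<Rightarrow> if i = i' then 1 else 0 | Inr j \<Rightarrow> A $$ (j, i))" for i w
  have W: "finite W" by (simp add: W_def)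
  have aInl: "(\<Sum>i\<in>?I. f i * a i (Inl i')) = f i'" if "i' < dim_col A" for f :: "nat \<Rightarrow> rat" and i'
    using that by (simp add: a_def if_distrib[of "\<lambda>x. _ * x"] cong: if_cong)
  have aInr: "(\<Sum>i\<in>?I. f i * a i (Inr j)) = (\<Sum>i\<in>?I. A $$ (j, i) * f i)" for f :: "nat \<Rightarrow> rat" and j
    by (simp add: a_def mult.commute)
  define Q where "Q n x y \<longleftrightarrow> (\<forall>i<dim_col A. 0 < x i) \<and> (\<forall>j<dim_row A. 0 < y j) \<and>
      (\<forall>j<dim_row A. (\<Sum>i\<in>?I. A $$ (j, i) * of_nat (x i)) = of_nat (y j)) \<and>
      (\<forall>j<dim_row A. \<forall>j'<dim_row A. \<bar>ln (real (y j) / real (y j'))\<bar> < 1 / real (Suc n) \<or>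
        real n \<le> \<bar>ln (real (y j) / real (y j'))\<bar>)" for n and x y :: "nat \<Rightarrow> nat"
  have "\<exists>x y. Q n x y" for n
  proof -
    obtain \<chi> :: "nat \<Rightarrow> nat" where \<chi>: "finite (range \<chi>)"
      "\<forall>p q. 0 < p \<longrightarrow> 0 < q \<longrightarrow> \<chi> p = \<chi> q \<longrightarrow>
        \<bar>ln (real p / real q)\<bar> < 1 / real (Suc n) \<or> real (Suc n - 1) \<le> \<bar>ln (real p / real q)\<bar>"
      using log_coloring[OF zero_less_Suc[of n]] by (elim exE conjE)
    obtain x y where xy: "\<And>i. i < dim_col A \<Longrightarrow> 0 < x i" "\<And>j. j < dim_row A \<Longrightarrow> 0 < y j"
      "\<And>j j'. j < dim_row A \<Longrightarrow> j' < dim_row A \<Longrightarrow> \<chi> (y j) = \<chi> (y j')"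
      "\<And>j. j < dim_row A \<Longrightarrow> (\<Sum>i\<in>?I. A $$ (j, i) * of_nat (x i)) = of_nat (y j)"
      by (rule image_partition_regular_solution[OF A \<chi>(1)]) (use that in auto)
    have "\<bar>ln (real (y j) / real (y j'))\<bar> < 1 / real (Suc n) \<or> real n \<le> \<bar>ln (real (y j) / real (y j'))\<bar>"
      if "j < dim_row A" "j' < dim_row A" for j j'
      using \<chi>(2)[rule_format, OF xy(2)[OF that(1)] xy(2)[OF that(2)] xy(3)[OF that]] by simp
    then show ?thesis unfolding Q_def using xy(1,2,4) by (intro exI[of _ x] exI[of _ y]) simp
  qed
  then obtain x y where Q: "\<And>n. Q n (x n) (y n)" by metis
  have x: "\<And>n i. i < dim_col A \<Longrightarrow> 0 < x n i"
    and y: "\<And>n j. j < dim_row A \<Longrightarrow> 0 < y n j"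
    and xy: "\<And>n j. j < dim_row A \<Longrightarrow> (\<Sum>i\<in>?I. A $$ (j, i) * of_nat (x n i)) = of_nat (y n j)"
    and log: "\<And>n j j'. j < dim_row A \<Longrightarrow> j' < dim_row A \<Longrightarrow>
      \<bar>ln (real (y n j) / real (y n j'))\<bar> < 1 / real (Suc n) \<or> real n \<le> \<bar>ln (real (y n j) / real (y n j'))\<bar>"
    using Q unfolding Q_def by blast+
  define z where "z n w = (\<Sum>i\<in>?I. real (x n i) * of_rat (a i w))" for n w
  have z_rat: "z n w = of_rat (\<Sum>i\<in>?I. of_nat (x n i) * a i w)" for n w
    by (simp add: z_def of_rat_sum of_rat_mult)
  have zl: "z n (Inl i) = real (x n i)" if "i < dim_col A" for n i
    unfolding z_rat aInl[OF that] by simp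
  have zr: "z n (Inr j) = real (y n j)" if "j < dim_row A" for n j
    unfolding z_rat aInr xy[OF that] by simp
  have z_pos: "0 < z n w" if "w \<in> W" for n w
    using that x y by (auto simp: W_def zl zr)
  have z_log: "\<bar>ln (z n w / z n w')\<bar> < 1 / real (Suc n) \<or> real n \<le> \<bar>ln (z n w / z n w')\<bar>"
    if "w \<in> Inr ` ?J" "w' \<in> Inr ` ?J" for n w w'
  proof -
    from that obtain j j' where "w = Inr j" "j < dim_row A" "w' = Inr j'" "j' < dim_row A" by blast
    then show ?thesis using log[of j j' n] by (simp only: zr)
  qed
  obtain lev :: "nat + nat \<Rightarrow> nat" and g :: "nat \<Rightarrow> nat \<Rightarrow> rat" where
    lev: "\<And>w. w \<in> W \<Longrightarrow> lev w \<le> card W" and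
    g: "\<And>w k. w \<in> W \<Longrightarrow> k < lev w \<Longrightarrow> (\<Sum>i\<in>?I. g k i * a i w) = 0"
      "\<And>w. w \<in> W \<Longrightarrow> 0 < (\<Sum>i\<in>?I. g (lev w) i * a i w)"
      "\<And>w w'. w \<in> Inr ` ?J \<Longrightarrow> w' \<in> Inr ` ?J \<Longrightarrow> lev w = lev w' \<Longrightarrow>
        (\<Sum>i\<in>?I. g (lev w) i * a i w) = (\<Sum>i\<in>?I. g (lev w) i * a i w')"
  proof (rule leading_terms[where I = ?I and W = W and a = a and Y = "Inr ` ?J" and x = "\<lambda>n i. real (x n i)"])
    fix lev g
    assume lg: "\<And>w. w \<in> W \<Longrightarrow> lev w \<le> card W"
      "\<And>w k. w \<in> W \<Longrightarrow> k < lev w \<Longrightarrow> (\<Sum>i\<in>?I. g k i * a i w) = 0"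
      "\<And>w. w \<in> W \<Longrightarrow> 0 < (\<Sum>i\<in>?I. g (lev w) i * a i w)"
      "\<And>w w'. w \<in> Inr ` ?J \<Longrightarrow> w' \<in> Inr ` ?J \<Longrightarrow> lev w = lev w' \<Longrightarrow>
        (\<Sum>i\<in>?I. g (lev w) i * a i w) = (\<Sum>i\<in>?I. g (lev w) i * a i w')"
    show thesis by (rule that[OF lg])
  qed (use W z_pos z_log in \<open>simp_all add: z_def W_def\<close>)
  obtain h :: "nat \<Rightarrow> nat \<Rightarrow> rat" where
    h: "\<And>w k. w \<in> W \<Longrightarrow> 0 \<le> (\<Sum>i\<in>?I. h k i * a i w)"
      "\<And>w k. w \<in> W \<Longrightarrow> k < lev w \<Longrightarrow> (\<Sum>i\<in>?I. h k i * a i w) = 0"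
      "\<And>w. w \<in> W \<Longrightarrow> (\<Sum>i\<in>?I. h (lev w) i * a i w) = (\<Sum>i\<in>?I. g (lev w) i * a i w)"
  proof (rule nonnegative_leading_terms[where I = ?I and W = W and a = a and g = g and lev = lev])
    fix h
    assume h: "\<And>w k. w \<in> W \<Longrightarrow> 0 \<le> (\<Sum>i\<in>?I. h k i * a i w)"
      "\<And>w k. w \<in> W \<Longrightarrow> k < lev w \<Longrightarrow> (\<Sum>i\<in>?I. h k i * a i w) = 0"
      "\<And>w. w \<in> W \<Longrightarrow> (\<Sum>i\<in>?I. h (lev w) i * a i w) = (\<Sum>i\<in>?I. g (lev w) i * a i w)"
    show thesis by (rule that[OF h])
  qed (use W g in simp_all)
  define L where "L k w = (\<Sum>i\<in>?I. h k i * a i w)" for k w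
  define m where "m = Suc (card W)"
  obtain D :: nat where D: "0 < D" "\<forall>q\<in>(\<lambda>(k, w). L k w) ` ({..<m} \<times> W). of_nat D * q \<in> \<int>"
    using common_denominator[of "(\<lambda>(k, w). L k w) ` ({..<m} \<times> W)"] W by auto
  have "\<exists>n :: nat. of_nat D * L k w = of_nat n" if "k < m" "w \<in> W" for k w
  proof -
    have "of_nat D * L k w \<in> \<int>" "0 \<le> of_nat D * L k w"
      using D(2) h(1)[OF that(2)] that by (auto simp: L_def)
    then show ?thesis by (metis Ints_cases nonneg_int_cases of_int_0_le_iff of_int_of_nat_eq)
  qed
  then obtain v :: "nat \<Rightarrow> nat + nat \<Rightarrow> nat" where
    v: "\<And>k w. k < m \<Longrightarrow> w \<in> W \<Longrightarrow> of_nat D * L k w = of_nat (v k w)"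
    by metis
  have lev_m: "lev w < m" if "w \<in> W" for w using lev[OF that] by (simp add: m_def)
  have Inl_W: "Inl i \<in> W" if "i < dim_col A" for i using that by (simp add: W_def)
  have Inr_W: "Inr j \<in> W" if "j < dim_row A" for j using that by (simp add: W_def)
  have v_pos: "v (lev w) w \<noteq> 0" if "w \<in> W" for w
  proof -
    have "0 < of_nat D * L (lev w) w" using g(2)[OF that] h(3)[OF that] D(1) by (simp add: L_def)
    then show ?thesis using v[OF lev_m[OF that] that] by simp
  qed
  have v_zero: "v k w = 0" if "w \<in> W" "k < lev w" for k w
    using v[OF less_trans[OF that(2) lev_m[OF that(1)]] that(1)] h(2)[OF that] by (simp add: L_def)
  have v_same: "v k (Inr j) = v k (Inr j')"
    if "j < dim_row A" "j' < dim_row A" "lev (Inr j) = k" "lev (Inr j') = k" for j j' k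
  proof -
    have "L k (Inr j) = L k (Inr j')"
      using g(3)[of "Inr j" "Inr j'"] h(3)[OF Inr_W[OF that(1)]] h(3)[OF Inr_W[OF that(2)]] that
      by (simp add: L_def)
    moreover have "k < m" using lev_m[OF Inr_W[OF that(1)]] that(3) by simp
    ultimately have "of_nat (v k (Inr j)) = (of_nat (v k (Inr j')) :: rat)"
      using v[of k "Inr j"] v[of k "Inr j'"] Inr_W that(1,2) by simp
    then show ?thesis by simp
  qed
  \<comment> \<open>If no row has level \<open>k\<close>, then no first entry stands in column \<open>k\<close> and \<open>1\<close> serves as a default.\<close>
  define c where "c k = (if \<exists>j<dim_row A. lev (Inr j) = k
      then v k (Inr (SOME j. j < dim_row A \<and> lev (Inr j) = k)) else 1)" for k
  have c: "c (lev (Inr j)) = v (lev (Inr j)) (Inr j)" if "j < dim_row A" for j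
  proof -
    let ?j = "SOME j'. j' < dim_row A \<and> lev (Inr j') = lev (Inr j)"
    have "?j < dim_row A \<and> lev (Inr ?j) = lev (Inr j)" by (rule someI[of _ j]) (simp add: that)
    then show ?thesis using v_same[of ?j j "lev (Inr j)"] that by (auto simp: c_def)
  qed
  show thesis
  proof (rule that[of m "\<lambda>i k. v k (Inl i)" c "\<lambda>j. lev (Inr j)" "\<lambda>j k. v k (Inr j)"])
    fix i assume "i < dim_col A"
    then show "\<exists>k<m. v k (Inl i) \<noteq> 0" using lev_m v_pos Inl_W by blast
  next
    fix k show "0 < c k"
    proof (cases "\<exists>j<dim_row A. lev (Inr j) = k")
      case True
      then obtain j where "j < dim_row A" "lev (Inr j) = k" by blast
      then show ?thesis using c[of j] v_pos[OF Inr_W, of j] by simp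
    next
      case False
      then show ?thesis unfolding c_def by (simp only: if_False)
    qed
  next
    fix j k assume jk: "j < dim_row A" "k < m"
    have "(\<Sum>i<dim_col A. A $$ (j, i) * of_nat (v k (Inl i)))
        = (\<Sum>i<dim_col A. A $$ (j, i) * (of_nat D * h k i))"
    proof (rule sum.cong)
      fix i assume "i \<in> ?I"
      then have i: "i < dim_col A" by simp
      then show "A $$ (j, i) * of_nat (v k (Inl i)) = A $$ (j, i) * (of_nat D * h k i)"
        using v[OF jk(2) Inl_W[OF i]] by (simp add: L_def aInl)
    qed simp
    also have "\<dots> = of_nat D * L k (Inr j)"
      unfolding L_def aInr sum_distrib_left by (simp add: mult.left_commute)
    finally show "(\<Sum>i<dim_col A. A $$ (j, i) * of_nat (v k (Inl i))) = of_nat (v k (Inr j))"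
      using v[OF jk(2) Inr_W[OF jk(1)]] by simp
  qed (simp_all add: lev_m Inr_W c v_zero)
qed

text \<open>With \<open>A G = B\<close> as above, a vector \<open>y\<close> over \<open>S\<close> with \<open>B y\<close> in \<open>D\<close> yields \<open>x = G y\<close>. The entries of \<open>x\<close>
  lie in \<open>S\<close> because they are nonempty sums of entries of \<open>y\<close>.\<close>

lemma image_partition_regular_in_minimal_idempotent:
  fixes S :: "real set"
  assumes S: "\<And>x y. x \<in> S \<Longrightarrow> y \<in> S \<Longrightarrow> x + y \<in> S"
    and P: "P \<in> left_minimal (near_zero_ultras S)" "P \<boxplus> P = P"
    and mult: "\<And>c :: nat. 0 < c \<Longrightarrow> (\<lambda>s. real c * s) ` S \<in> P"
    and A: "image_partition_regular A" and "D \<in> P"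
  obtains x where "\<And>i. i < dim_col A \<Longrightarrow> x i \<in> S"
    "\<And>j. j < dim_row A \<Longrightarrow> (\<Sum>i<dim_col A. of_rat (A $$ (j, i)) * x i) \<in> D"
proof (rule image_partition_regular_first_entries[OF A])
  fix m and G B :: "nat \<Rightarrow> nat \<Rightarrow> nat" and lev c
  assume
    G: "\<And>i. i < dim_col A \<Longrightarrow> \<exists>k<m. G i k \<noteq> 0" and
    c: "\<And>k. 0 < c k" and
    B: "\<And>j. j < dim_row A \<Longrightarrow> lev j < m"
      "\<And>j. j < dim_row A \<Longrightarrow> B j (lev j) = c (lev j)"
      "\<And>j k. j < dim_row A \<Longrightarrow> k < lev j \<Longrightarrow> B j k = 0" and
    AG: "\<And>j k. j < dim_row A \<Longrightarrow> k < m \<Longrightarrow>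
      (\<Sum>i<dim_col A. A $$ (j, i) * of_nat (G i k)) = of_nat (B j k)"
  obtain y where y: "\<And>k. k < m \<Longrightarrow> y k \<in> S"
    "\<And>j. j \<in> {..<dim_row A} \<Longrightarrow> (\<Sum>k<m. real (B j k) * y k) \<in> D"
    by (rule first_entries_image[where S = S and P = P and c = c and lev = lev and m = m
          and J = "{..<dim_row A}" and B = B and D = D])
      (auto simp: S P mult c B \<open>D \<in> P\<close>)
  define x where "x i = (\<Sum>k<m. real (G i k) * y k)" for i
  have "x i \<in> S" if "i < dim_col A" for i
    unfolding x_def by (rule nat_combination_mem[OF S]) (use y(1) G[OF that] in auto)
  moreover have "(\<Sum>i<dim_col A. of_rat (A $$ (j, i)) * x i) \<in> D" if j: "j < dim_row A" for j
  proof -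
    have "(\<Sum>i<dim_col A. of_rat (A $$ (j, i)) * x i)
        = (\<Sum>k<m. of_rat (\<Sum>i<dim_col A. A $$ (j, i) * of_nat (G i k)) * y k)"
      unfolding x_def of_rat_sum of_rat_mult sum_distrib_left sum_distrib_right
      by (subst sum.swap) (simp add: mult.assoc)
    also have "\<dots> = (\<Sum>k<m. real (B j k) * y k)" using AG[OF j] by simp
    finally show ?thesis using y(2) j by simp
  qed
  ultimately show thesis by (rule that)
qed

section \<open>Segmented matrices\<close>

text \<open>In contrast to \<open>C\<close>, the set \<open>C'\<close> allows sums to be continued indefinitely: whatever
  \<open>x \<in> C'\<close> has been reached, almost every \<open>y\<close> keeps \<open>x + y\<close> in \<open>C'\<close>.\<close>

lemma idempotent_star:
  fixes P :: "'a::semigroup_add set set"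
  assumes P: "P \<in> ultras" "P \<boxplus> P = P" and C: "C \<in> P"
  defines "C' \<equiv> {x\<in>C. {y. x + y \<in> C} \<in> P}"
  shows "C' \<in> P" and "\<And>x. x \<in> C' \<Longrightarrow> {y. x + y \<in> C'} \<in> P"
proof -
  have idem: "{x. {y. x + y \<in> B} \<in> P} \<in> P" if "B \<in> P" for B
    using that P(2) mem_ultra_plus[of B P P] by simp
  have "C' = C \<inter> {x. {y. x + y \<in> C} \<in> P}" by (auto simp: C'_def)
  then show "C' \<in> P" using C idem[OF C] ultra_Int[OF P(1)] by simp
  fix x assume "x \<in> C'"
  then have B: "{y. x + y \<in> C} \<in> P" by (simp add: C'_def)
  have "{y. x + y \<in> C'} = {y. x + y \<in> C} \<inter> {y. {z. y + z \<in> {y. x + y \<in> C}} \<in> P}"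
    by (auto simp: C'_def add.assoc)
  then show "{y. x + y \<in> C'} \<in> P" using B idem[OF B] ultra_Int[OF P(1)] by simp
qed

text \<open>A row that vanishes on the block imposes no condition, and a block with only such rows is solved
  by any element of \<open>S\<close>.\<close>

lemma block_solution:
  fixes S :: "real set" and M :: "nat \<Rightarrow> nat \<Rightarrow> rat"
  assumes S: "\<And>x y. x \<in> S \<Longrightarrow> y \<in> S \<Longrightarrow> x + y \<in> S" "S \<noteq> {}"
    and P: "P \<in> left_minimal (near_zero_ultras S)" "P \<boxplus> P = P"
    and mult: "\<And>c :: nat. 0 < c \<Longrightarrow> (\<lambda>s. real c * s) ` S \<in> P"
    and block: "block_rows M k l = {} \<or>
      (\<exists>A. image_partition_regular A \<and> block_rows M k l = set (rows A))"
    and "D \<in> P"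
  shows "\<exists>z. (\<forall>j<l - k. z j \<in> S) \<and> (\<forall>i. (\<forall>j<l - k. M i (k + j) = 0) \<or>
    (\<Sum>j<l - k. of_rat (M i (k + j)) * z j) \<in> D)"
proof -
  define v where "v i = vec (l - k) (\<lambda>j. M i (k + j))" for i
  have nz: "v i \<in> block_rows M k l" if "\<not> (\<forall>j<l - k. M i (k + j) = 0)" for i
    using that by (auto simp: v_def block_rows_def vec_eq_iff)
  from block show ?thesis
  proof (elim disjE exE conjE)
    assume "block_rows M k l = {}"
    then have "\<forall>i. \<forall>j<l - k. M i (k + j) = 0" using nz by blast
    moreover obtain s where "s \<in> S" using S(2) by blast
    ultimately show ?thesis by (intro exI[of _ "\<lambda>_. s"]) auto
  next
    fix A assume A: "image_partition_regular A" and rows: "block_rows M k l = set (rows A)"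
    have "row A 0 \<in> set (rows A)"
      using A by (auto simp: image_partition_regular_def rows_def)
    then obtain i where "row A 0 = vec (l - k) (\<lambda>j. M i (k + j))"
      unfolding rows[symmetric] block_rows_def by auto
    then have "dim_vec (row A 0) = dim_vec (vec (l - k) (\<lambda>j. M i (k + j)))" by (rule arg_cong)
    then have dc: "dim_col A = l - k" by simp
    obtain z where z: "\<And>j. j < dim_col A \<Longrightarrow> z j \<in> S"
      "\<And>j. j < dim_row A \<Longrightarrow> (\<Sum>i<dim_col A. of_rat (A $$ (j, i)) * z i) \<in> D"
      by (rule image_partition_regular_in_minimal_idempotent[OF S(1) P mult A \<open>D \<in> P\<close>]) (use that in auto)
    have "(\<Sum>j<l - k. of_rat (M i (k + j)) * z j) \<in> D" if "\<not> (\<forall>j<l - k. M i (k + j) = 0)" for i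
    proof -
      have "v i \<in> set (rows A)" using nz[OF that] rows by simp
      then obtain j where j: "j < dim_row A" "v i = row A j" by (auto simp: rows_def)
      have "M i (k + t) = A $$ (j, t)" if "t < l - k" for t
      proof -
        have "v i $ t = M i (k + t)" using that by (simp add: v_def)
        then show ?thesis unfolding j(2) using j(1) that dc by simp
      qed
      then have "(\<Sum>t<l - k. of_rat (M i (k + t)) * z t) = (\<Sum>t<dim_col A. of_rat (A $$ (j, t)) * z t)"
        unfolding dc by (intro sum.cong) auto
      then show ?thesis using z(2)[OF j(1)] by simp
    qed
    then show ?thesis using z(1) dc by (intro exI[of _ z]) auto
  qed
qed

lemma sum_lessThan_add: "(\<Sum>j<k + l. f j) = (\<Sum>j<k. f j) + (\<Sum>j<l. f (k + j))"
  for f :: "nat \<Rightarrow> 'a::comm_monoid_add"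
  by (induction l) (simp_all add: add.assoc)

theorem theorem3p1:
  fixes S :: "real set" and M :: "nat \<Rightarrow> nat \<Rightarrow> rat"
  assumes "dense_subsemigroup S"
    and "\<And>c :: nat. 0 < c \<Longrightarrow> central_star_near_zero S ((\<lambda>s. real c * s) ` S)"
    and "segmented_image_partition_regular M"
  shows "centrally_image_partition_regular_near_zero S M"
  unfolding centrally_image_partition_regular_near_zero_def
proof (intro allI impI)
  fix C assume "central_near_zero S C"
  then obtain p where p: "minimal_idempotent_near_zero S p" "C \<in> p"
    unfolding central_near_zero_def by blast
  have S: "x + y \<in> S" if "x \<in> S" "y \<in> S" for x y
    using assms(1) that by (simp add: dense_subsemigroup_def)
  have small: "{0<..<\<epsilon>} \<inter> S \<noteq> {}" if "\<epsilon> > 0" for \<epsilon>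
  proof -
    have "\<epsilon> / 2 \<in> closure S" using assms(1) that by (auto simp: dense_subsemigroup_def)
    then have "\<exists>s\<in>S. dist s (\<epsilon> / 2) < \<epsilon> / 2"
      using that unfolding closure_approachable by (elim allE[of _ "\<epsilon> / 2"]) simp
    then obtain s where "s \<in> S" "dist s (\<epsilon> / 2) < \<epsilon> / 2" by (elim bexE)
    moreover from this(2) have "0 < s" "s < \<epsilon>" unfolding dist_real_def by linarith+
    ultimately have "s \<in> {0<..<\<epsilon>} \<inter> S" by simp
    then show ?thesis by blast
  qed
  have S_ne: "S \<noteq> {}" using small[of 1] by auto
  obtain P where P: "P \<in> left_minimal (near_zero_ultras S)" "P \<boxplus> P = P" and pP: "p = P \<inter> Pow S"
    by (rule minimal_idempotent_extends[OF S small p(1)]) (use that in auto)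
  have Pu: "P \<in> ultras" using P(1) by (simp add: left_minimal_def near_zero_ultras_iff)
  have mult: "(\<lambda>s. real c * s) ` S \<in> P" if "0 < c" for c :: nat
    using assms(2)[OF that] p(1) pP unfolding central_star_near_zero_def by blast
  define C' where "C' = {x\<in>C. {y. x + y \<in> C} \<in> P}"
  have "C \<in> P" using p(2) pP by blast
  note star = idempotent_star[OF Pu P(2) this, folded C'_def]
  obtain \<alpha> :: "nat \<Rightarrow> nat" where \<alpha>: "strict_mono \<alpha>" "\<alpha> 0 = 0"
    and block: "\<And>n. block_rows M (\<alpha> n) (\<alpha> (Suc n)) = {} \<or>
      (\<exists>A. image_partition_regular A \<and> block_rows M (\<alpha> n) (\<alpha> (Suc n)) = set (rows A))"
    and fin: "\<And>i. finite {j. M i j \<noteq> 0}" and nz: "\<And>i. \<exists>j. M i j \<noteq> 0"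
    using assms(3) unfolding segmented_image_partition_regular_def by auto
  define val where "val n x i = (\<Sum>j<\<alpha> n. of_rat (M i j) * x j)" for n i and x :: "nat \<Rightarrow> real"
  \<comment> \<open>After \<open>n\<close> blocks, the partial row sums that are not trivial lie in \<open>C'\<close>. They form a finite set,
    which leaves only finitely many conditions for the next block.\<close>
  define Inv where "Inv n x \<longleftrightarrow> (\<forall>j<\<alpha> n. x j \<in> S) \<and> finite (range (val n x)) \<and>
    (\<forall>i. (\<forall>j<\<alpha> n. M i j = 0) \<or> val n x i \<in> C')" for n x
  have step: "\<exists>x'. Inv (Suc n) x' \<and> (\<forall>j<\<alpha> n. x' j = x j)" if Inv: "Inv n x" for n x
  proof -
    define l where "l = \<alpha> (Suc n) - \<alpha> n"
    have \<alpha>_Suc: "\<alpha> (Suc n) = \<alpha> n + l"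
      using strict_monoD[OF \<alpha>(1), of n "Suc n"] by (simp add: l_def)
    define D where "D = C' \<inter> (\<Inter>s\<in>range (val n x) \<inter> C'. {y. s + y \<in> C'})"
    have "(\<Inter>s\<in>range (val n x) \<inter> C'. {y. s + y \<in> C'}) \<in> P"
      using Inv star(2) by (intro ultra_INT[OF Pu]) (auto simp: Inv_def)
    then have "D \<in> P" unfolding D_def using star(1) by (simp add: ultra_Int[OF Pu])
    then obtain z where z: "\<And>j. j < l \<Longrightarrow> z j \<in> S"
      "\<And>i. (\<forall>j<l. M i (\<alpha> n + j) = 0) \<or> (\<Sum>j<l. of_rat (M i (\<alpha> n + j)) * z j) \<in> D"
      using block_solution[OF S S_ne P mult block, of D n] unfolding l_def by auto
    define w where "w i = (\<Sum>j<l. of_rat (M i (\<alpha> n + j)) * z j)" for i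
    define x' where "x' j = (if j < \<alpha> n then x j else z (j - \<alpha> n))" for j
    have val': "val (Suc n) x' i = val n x i + w i" for i
      by (simp add: val_def \<alpha>_Suc sum_lessThan_add w_def x'_def)
    have "Inv (Suc n) x'"
      unfolding Inv_def
    proof (intro conjI allI impI)
      fix j assume "j < \<alpha> (Suc n)"
      then show "x' j \<in> S" using Inv z(1)[of "j - \<alpha> n"] by (auto simp: x'_def Inv_def \<alpha>_Suc)
    next
      have "finite (block_rows M (\<alpha> n) (\<alpha> (Suc n)))" using block[of n] by auto
      moreover have "w i \<in> (\<lambda>v. \<Sum>j<l. of_rat (v $ j) * z j) ` insert (0\<^sub>v l) (block_rows M (\<alpha> n) (\<alpha> (Suc n)))" for i
      proof -
        have "vec l (\<lambda>j. M i (\<alpha> n + j)) \<in> insert (0\<^sub>v l) (block_rows M (\<alpha> n) (\<alpha> (Suc n)))"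
          by (auto simp: block_rows_def l_def)
        moreover have "w i = (\<Sum>j<l. of_rat (vec l (\<lambda>j. M i (\<alpha> n + j)) $ j) * z j)" by (simp add: w_def)
        ultimately show ?thesis by blast
      qed
      then have "range w \<subseteq> (\<lambda>v. \<Sum>j<l. of_rat (v $ j) * z j) ` insert (0\<^sub>v l) (block_rows M (\<alpha> n) (\<alpha> (Suc n)))" by blast
      ultimately have "finite (range w)" by (meson finite_imageI finite_insert finite_subset)
      moreover have "finite (range (val n x))" using Inv by (simp add: Inv_def)
      ultimately have "finite ((\<lambda>(s, t). s + t) ` (range (val n x) \<times> range w))" by simp
      moreover have "range (val (Suc n) x') \<subseteq> (\<lambda>(s, t). s + t) ` (range (val n x) \<times> range w)"
        by (auto simp: val')
      ultimately show "finite (range (val (Suc n) x'))" by (rule finite_subset[rotated])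
    next
      fix i
      show "(\<forall>j<\<alpha> (Suc n). M i j = 0) \<or> val (Suc n) x' i \<in> C'"
      proof (cases "\<forall>j<l. M i (\<alpha> n + j) = 0")
        case True
        then have "w i = 0" by (simp add: w_def)
        moreover have "M i j = 0" if "\<forall>j<\<alpha> n. M i j = 0" "j < \<alpha> n + l" for j
          using that True[rule_format, of "j - \<alpha> n"] by (cases "j < \<alpha> n") auto
        ultimately show ?thesis using Inv by (auto simp: Inv_def val' \<alpha>_Suc)
      next
        case False
        then have wD: "w i \<in> D" using z(2)[of i] unfolding w_def by blast
        show ?thesis
        proof (cases "\<forall>j<\<alpha> n. M i j = 0")
          case True
          then have "val n x i = 0" by (simp add: val_def)
          then show ?thesis using wD by (simp add: val' D_def)
        next
          case False
          then have "val n x i \<in> C'" using Inv unfolding Inv_def by blast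
          then show ?thesis using wD by (auto simp: val' D_def)
        qed
      qed
    qed
    then show ?thesis by (intro exI[of _ x']) (simp add: x'_def)
  qed
  have "\<exists>f. \<forall>n. Inv n (f n) \<and> (\<forall>j<\<alpha> n. f (Suc n) j = f n j)"
  proof (rule dependent_nat_choice)
    show "\<exists>x. Inv 0 x" by (intro exI[of _ "\<lambda>_. 0"]) (simp add: Inv_def val_def \<alpha>(2))
  qed (rule step)
  then obtain f where f: "\<And>n. Inv n (f n)" "\<And>n j. j < \<alpha> n \<Longrightarrow> f (Suc n) j = f n j" by blast
  have mono: "\<alpha> n \<le> \<alpha> m" if "n \<le> m" for n m
    using \<alpha>(1) that by (simp add: strict_mono_less_eq)
  have f_eq: "f m j = f n j" if "n \<le> m" "j < \<alpha> n" for n m j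
    using that
  proof (induction m rule: dec_induct)
    case (step m)
    then have "j < \<alpha> m" using mono[of n m] by simp
    then show ?case using step f(2) by simp
  qed simp
  \<comment> \<open>Entry \<open>j\<close> is settled at stage \<open>Suc j\<close> at the latest, since \<open>j < \<alpha> (Suc j)\<close>.\<close>
  define X where "X j = f (Suc j) j" for j
  have \<alpha>_gt: "j < \<alpha> (Suc j)" for j using seq_suble[OF \<alpha>(1), of "Suc j"] by simp
  have X: "X j = f n j" if "j < \<alpha> n" for n j
    unfolding X_def using f_eq[of "Suc j" n j] f_eq[of n "Suc j" j] that \<alpha>_gt[of j]
    by (cases "Suc j \<le> n") auto
  have "X j \<in> S" for j
    using f(1)[of "Suc j"] \<alpha>_gt[of j] by (simp add: X_def Inv_def)
  moreover have "mat_image M X i \<in> C" for i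
  proof -
    obtain b where b: "\<And>j. M i j \<noteq> 0 \<Longrightarrow> j < b"
      using fin[of i] by (metis (mono_tags) finite_nat_set_iff_bounded mem_Collect_eq)
    have sub: "{j. M i j \<noteq> 0} \<subseteq> {..<\<alpha> b}"
      using b seq_suble[OF \<alpha>(1), of b] by (auto intro: less_le_trans)
    have "mat_image M X i = (\<Sum>j<\<alpha> b. of_rat (M i j) * X j)"
      unfolding mat_image_def using sub by (intro sum.mono_neutral_left) auto
    also have "\<dots> = val b (f b) i" unfolding val_def using X by (intro sum.cong) auto
    finally have eq: "mat_image M X i = val b (f b) i" .
    obtain j where "M i j \<noteq> 0" using nz by blast
    then have "\<not> (\<forall>j<\<alpha> b. M i j = 0)" using sub by auto
    then have "val b (f b) i \<in> C'" using f(1)[of b] unfolding Inv_def by blast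
    then show ?thesis by (simp add: eq C'_def)
  qed
  ultimately show "\<exists>x. (\<forall>j. x j \<in> S) \<and> (\<forall>i. mat_image M x i \<in> C)" by blast
qed

end
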